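(* There is $N$ such that for every integer $n_0\ge N$ there exist a real $2\times2$ matrix function $A$ on $\mathbb{T}^2\times\mathbb{R}^+$ in the regularity class $R(80,60)$ and a non-zero, uniformly $C^2$ real function $u$ on $\mathbb{T}^2\times\mathbb{R}^+$ with $\ddot u+\operatorname{div}(A\nabla u)=0$, and constants $c,C>0$ (depending on $n_0$) with $\sup_{\mathbb{T}^2\times\{t\ge T\}}|u|\le Ce^{-ce^{cT}}$ for all sufficiently large $T$. More precisely, there is an increasing sequence $t_n\ge0$ with $t_1=0$, $t_{n+1}-t_n>\frac3{100}$, $t_n\to\infty$, and a sequence of positive numbers $c_n$ with $c_1=1$, such that, with $k_n=2^{n+n_0-1}$: for odd $n$, on $\mathbb{T}^2\times[t_n,t_{n+1}]$ one has $u=f_n(t)\cos(k_nx)+g_{n+1}(t)\cos(k_{n+1}y)$ with $f_n,g_{n+1}$ uniformly $C^2$ on $\mathbb{R}^+$; on $\mathbb{T}^2\times[t_n,t_n+\frac1{100}]$, $u=c_n\cos(k_nx)e^{-k_nt}$ and $A=\mathrm{Id}$; on $\mathbb{T}^2\times[t_{n+1}-\frac1{100},t_{n+1}]$, $u=c_{n+1}\cos(k_{n+1}y)e^{-k_{n+1}t}$ and $A=\mathrm{Id}$; for even $n$ the same holds with the roles of $x$ and $y$ exchanged.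
   Context: $\mathbb{T}^2=(\mathbb{R}/2\pi\mathbb{Z})^2$ with coordinates $(x,y)$; $t\ge0$ the third coordinate. $\ddot u+\operatorname{div}(A\nabla u)$ means $\partial_t^2u+\sum_{i,j\in\{x,y\}}\partial_i(A_{ij}\partial_ju)$. Regularity class $R(\Lambda,C)$: $\Lambda^{-1}|\xi|^2\le\xi^TA\xi\le\Lambda|\xi|^2$ for all $\xi\in\mathbb{R}^2$ at every point, and the entries of $A$ are $C^1$ with all first partial derivatives in $x,y,t$ bounded by $C$ in absolute value. Uniformly $C^2$: all partial derivatives of order $\le2$ continuous and bounded. *)

theory Defs
  imports "HOL-Analysis.Analysis"
begin

text \<open>Functions on T^2 x R^+ are represented as functions u x y t (x, y, t real),
  required to be 2 pi-periodic in x and y; only t >= 0 matters. Coordinate index: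
  0 = x, 1 = y, 2 = t. Derivatives in t are taken within {0..} (one-sided at t = 0).\<close>

type_synonym fn3 = "real \<Rightarrow> real \<Rightarrow> real \<Rightarrow> real"

definition periodic2 :: "fn3 \<Rightarrow> bool" where
  "periodic2 f \<longleftrightarrow> (\<forall>x y t. f (x + 2*pi) y t = f x y t \<and> f x (y + 2*pi) t = f x y t)"

definition is_pd :: "nat \<Rightarrow> fn3 \<Rightarrow> fn3 \<Rightarrow> bool" where
  "is_pd i f g \<longleftrightarrow> (\<forall>x y t. t \<ge> 0 \<longrightarrow>
     (if i = 0 then ((\<lambda>s. f s y t) has_real_derivative g x y t) (at x)
      else if i = 1 then ((\<lambda>s. f x s t) has_real_derivative g x y t) (at y)
      else ((\<lambda>s. f x y s) has_real_derivative g x y t) (at t within {0..})))"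

definition cont3 :: "fn3 \<Rightarrow> bool" where
  "cont3 f \<longleftrightarrow> continuous_on (UNIV \<times> UNIV \<times> {0..}) (\<lambda>(x, y, t). f x y t)"

definition bdd3 :: "fn3 \<Rightarrow> bool" where
  "bdd3 f \<longleftrightarrow> (\<exists>B. \<forall>x y t. t \<ge> 0 \<longrightarrow> \<bar>f x y t\<bar> \<le> B)"

definition unifC2 :: "fn3 \<Rightarrow> bool" where
  "unifC2 u \<longleftrightarrow> cont3 u \<and> bdd3 u \<and>
     (\<exists>Du DDu. \<forall>i<3. is_pd i u (Du i) \<and> cont3 (Du i) \<and> bdd3 (Du i) \<and>
        (\<forall>j<3. is_pd j (Du i) (DDu i j) \<and> cont3 (DDu i j) \<and> bdd3 (DDu i j)))"

definition unifC2_1 :: "(real \<Rightarrow> real) \<Rightarrow> bool" where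
  "unifC2_1 f \<longleftrightarrow> (\<exists>f1 f2.
     (\<forall>t\<ge>0. (f has_real_derivative f1 t) (at t within {0..}) \<and>
             (f1 has_real_derivative f2 t) (at t within {0..})) \<and>
     continuous_on {0..} f \<and> continuous_on {0..} f1 \<and> continuous_on {0..} f2 \<and>
     (\<exists>B. \<forall>t\<ge>0. \<bar>f t\<bar> \<le> B \<and> \<bar>f1 t\<bar> \<le> B \<and> \<bar>f2 t\<bar> \<le> B))"

definition regclass :: "real \<Rightarrow> real \<Rightarrow> (nat \<Rightarrow> nat \<Rightarrow> fn3) \<Rightarrow> bool" where
  "regclass \<Lambda> C A \<longleftrightarrow>
     (\<forall>x y t (\<xi>::nat \<Rightarrow> real). t \<ge> 0 \<longrightarrow>
        inverse \<Lambda> * (\<Sum>i<2. (\<xi> i)\<^sup>2) \<le> (\<Sum>i<2. \<Sum>j<2. \<xi> i * A i j x y t * \<xi> j) \<and>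
        (\<Sum>i<2. \<Sum>j<2. \<xi> i * A i j x y t * \<xi> j) \<le> \<Lambda> * (\<Sum>i<2. (\<xi> i)\<^sup>2)) \<and>
     (\<forall>i<2. \<forall>j<2. cont3 (A i j) \<and> (\<exists>D. \<forall>k<3. is_pd k (A i j) (D k) \<and> cont3 (D k) \<and>
        (\<forall>x y t. t \<ge> 0 \<longrightarrow> \<bar>D k x y t\<bar> \<le> C)))"

definition solves_eq :: "(nat \<Rightarrow> nat \<Rightarrow> fn3) \<Rightarrow> fn3 \<Rightarrow> bool" where
  "solves_eq A u \<longleftrightarrow> (\<exists>Du DDu G.
     (\<forall>i<3. is_pd i u (Du i) \<and> (\<forall>j<3. is_pd j (Du i) (DDu i j))) \<and>
     (\<forall>i<2. is_pd i (\<lambda>x y t. \<Sum>j<2. A i j x y t * Du j x y t) (G i)) \<and>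
     (\<forall>x y t. t \<ge> 0 \<longrightarrow> DDu 2 2 x y t + (\<Sum>i<2. G i x y t) = 0))"

definition is_Id :: "(nat \<Rightarrow> nat \<Rightarrow> fn3) \<Rightarrow> real \<Rightarrow> real \<Rightarrow> real \<Rightarrow> bool" where
  "is_Id A x y t \<longleftrightarrow> (\<forall>i<2. \<forall>j<2. A i j x y t = (if i = j then 1 else 0))"

end

(* The matrix A is not required to be symmetric, so a mode f(t) cos(k x) can be made a source for a
   mode g(t) cos(2k y) by changing only the first column of A, in a way that does not depend on g.
   The field (cos px cos qy / p, 2 sin px sin qy / q) sin px has divergence cos qy and vanishes where
   the x-derivative of cos px does; hence a source h(t) cos qy costs only a perturbation of A of
   size h/(p^2 f), whose derivatives are of size h/(p f).

   In each time interval of length 6, let s be the local time. The coefficient A_yy is 1 at first,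
   where g = 0 and it is irrelevant, and moves to 1/4, so that both modes would decay like exp(-k s).
   Then f feeds g until f = g; by the same mechanism, through the second column of A, g extinguishes f.
   Finally A_yy returns to 1, and the mode exp(-2k t) cos(2k y) is left. Here f and g are prescribed,
   and A_yy and the perturbation are read off the equations. Since each interval multiplies the
   amplitude by exp(-15 k / 2) and doubles k, the decay is doubly exponential. *)
theory Submission
  imports Defs
begin

section \<open>Smooth steps\<close>

text \<open>The constraint behind the design is that a coupling rate r changes A by about r/k^2 and
  its derivatives by about r/k, so r must be O(k). With A = Id the modes would decay like exp(-k s)
  and exp(-2k s), and extinguishing f by means of g would need a rate of size f/g, exponentially
  large in k. The value 1/4 = (k/(2k))^2 gives both modes the same exponent, which then cancels from
  every rate. Splitting the exchange in two avoids division by a vanishing amplitude: f is a pure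
  exponential while it feeds g, and g is one while it extinguishes f, so the denominator of each
  rate is exactly exp(-k s). The length 6 is made of four unit transitions and a unit of rest at
  each end, where A = Id and consecutive intervals are joined.\<close>

lemma DERIV_piecewise:
  fixes F G :: "real \<Rightarrow> real"
  assumes "\<And>t. (F has_real_derivative F' t) (at t)" "\<And>t. (G has_real_derivative G' t) (at t)"
    and "F c = G c" "F' c = G' c"
  shows "((\<lambda>t. if t \<le> c then F t else G t) has_real_derivative (if x \<le> c then F' x else G' x)) (at x)"
proof -
  have cl: "closure {..c} = {..c}" "closure {c<..} = {c..}" by auto
  have U: "UNIV = {..c} \<union> {c<..}" by auto
  have "((\<lambda>t. if t \<in> {..c} then F t else G t) has_vector_derivative
      (if x \<in> {..c} then F' x else G' x)) (at x within UNIV)"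
    by (rule has_vector_derivative_If_within_closures[where T = "{c<..}"])
      (use assms in \<open>auto simp: cl U has_real_derivative_iff_has_vector_derivative
         intro: has_vector_derivative_at_within\<close>)
  then show ?thesis by (simp add: has_real_derivative_iff_has_vector_derivative)
qed

lemma continuous_on_piecewise:
  fixes F G :: "real \<Rightarrow> real"
  assumes "continuous_on UNIV F" "continuous_on UNIV G" "F c = G c"
  shows "continuous_on UNIV (\<lambda>t. if t \<le> c then F t else G t)"
proof -
  have "continuous_on ({..c} \<union> {c..}) (\<lambda>t. if t \<le> c then F t else G t)"
    by (rule continuous_on_If) (use assms in \<open>auto intro: continuous_on_subset\<close>)
  moreover have "{..c} \<union> {c..} = UNIV" by auto
  ultimately show ?thesis by simp
qed

text \<open>\<open>step0\<close> is the smoothstep of degree 7, the normalised integral of s^3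
  (1-s)^3 with 140 = 7!/(3! 3!). Third-order zeros at both ends make \<open>step3\<close>
  continuous, so coupling rates built from \<open>step2\<close> are C^1. By symmetry
  \<open>step0\<close> has integral 1/2 over the unit interval, hence s - 1/2 in
  \<open>step_int\<close>.\<close>

definition step_int :: "real \<Rightarrow> real" where
  "step_int s = (if s \<le> 0 then 0 else if s \<le> 1 then 7 * s^5 - 14 * s^6 + 10 * s^7 - 5/2 * s^8 else s - 1/2)"
definition step0 :: "real \<Rightarrow> real" where
  "step0 s = (if s \<le> 0 then 0 else if s \<le> 1 then 35 * s^4 - 84 * s^5 + 70 * s^6 - 20 * s^7 else 1)"
definition step1 :: "real \<Rightarrow> real" where
  "step1 s = (if s \<le> 0 then 0 else if s \<le> 1 then 140 * s^3*(1-s)^3 else 0)"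
definition step2 :: "real \<Rightarrow> real" where
  "step2 s = (if s \<le> 0 then 0 else if s \<le> 1 then 420 * s^2*(1-s)^2*(1-2 * s) else 0)"
definition step3 :: "real \<Rightarrow> real" where
  "step3 s = (if s \<le> 0 then 0 else if s \<le> 1 then 840 * s*(1-s)*(1-5 * s*(1-s)) else 0)"

lemma DERIV_step_int: "(step_int has_real_derivative step0 s) (at s)"
proof -
  have 1: "((\<lambda>s. if s \<le> 1 then 7 * s^5 - 14 * s^6 + 10 * s^7 - 5/2 * s^8 else s - 1/2) has_real_derivative
    (if s \<le> 1 then 35 * s^4 - 84 * s^5 + 70 * s^6 - 20 * s^7 else 1)) (at s)" for s :: real
    by (rule DERIV_piecewise) (auto intro!: derivative_eq_intros simp: algebra_simps)
  show ?thesis unfolding step_int_def[abs_def] step0_def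
    by (rule DERIV_piecewise[OF _ 1]) (auto intro!: derivative_eq_intros)
qed

lemma DERIV_step0: "(step0 has_real_derivative step1 s) (at s)"
proof -
  have 1: "((\<lambda>s. if s \<le> 1 then 35 * s^4 - 84 * s^5 + 70 * s^6 - 20 * s^7 else 1) has_real_derivative
    (if s \<le> 1 then 140 * s^3*(1-s)^3 else 0)) (at s)" for s :: real
    by (rule DERIV_piecewise)
      (auto intro!: derivative_eq_intros simp: eval_nat_numeral algebra_simps)
  show ?thesis unfolding step0_def[abs_def] step1_def
    by (rule DERIV_piecewise[OF _ 1]) (auto intro!: derivative_eq_intros)
qed

lemma DERIV_step1: "(step1 has_real_derivative step2 s) (at s)"
proof -
  have 1: "((\<lambda>s. if s \<le> 1 then 140 * s^3*(1-s)^3 else 0) has_real_derivative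
    (if s \<le> 1 then 420 * s^2*(1-s)^2*(1-2 * s) else 0)) (at s)" for s :: real
    by (rule DERIV_piecewise)
      (auto intro!: derivative_eq_intros simp: eval_nat_numeral algebra_simps)
  show ?thesis unfolding step1_def[abs_def] step2_def
    by (rule DERIV_piecewise[OF _ 1]) (auto intro!: derivative_eq_intros)
qed

lemma DERIV_step2: "(step2 has_real_derivative step3 s) (at s)"
proof -
  have 1: "((\<lambda>s. if s \<le> 1 then 420 * s^2*(1-s)^2*(1-2 * s) else 0) has_real_derivative
    (if s \<le> 1 then 840 * s*(1-s)*(1-5 * s*(1-s)) else 0)) (at s)" for s :: real
    by (rule DERIV_piecewise)
      (auto intro!: derivative_eq_intros simp: eval_nat_numeral algebra_simps)
  show ?thesis unfolding step2_def[abs_def] step3_def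
    by (rule DERIV_piecewise[OF _ 1]) (auto intro!: derivative_eq_intros)
qed

lemma continuous_step3: "continuous_on UNIV step3"
proof -
  have 1: "continuous_on UNIV (\<lambda>s::real. if s \<le> 1 then 840 * s*(1-s)*(1-5 * s*(1-s)) else 0)"
    by (rule continuous_on_piecewise) (auto intro!: continuous_intros)
  show ?thesis unfolding step3_def[abs_def]
    by (rule continuous_on_piecewise[OF _ 1]) auto
qed

lemma unit_interval_product:
  fixes s :: real
  assumes "0 \<le> s" "s \<le> 1"
  shows "0 \<le> s * (1-s)" "s * (1-s) \<le> 1/4"
proof -
  show "0 \<le> s * (1-s)" using assms by simp
  have "0 \<le> (s - 1/2)^2" by simp
  then show "s * (1-s) \<le> 1/4" by (simp add: power2_eq_square algebra_simps)
qed

lemma step1_bounds: "0 \<le> step1 s" "step1 s \<le> 35/16"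
proof -
  show "0 \<le> step1 s" by (simp add: step1_def)
  \<comment> \<open>Since s(1-s) is at most 1/4, the bound is 140/64. The next two lemmas use 420/16
    and 840/4 in the same way.\<close>
  have "140 * s^3 * (1-s)^3 \<le> 35/16" if "0 \<le> s" "s \<le> 1"
    using power_mono[OF unit_interval_product(2,1)[OF that], of 3]
    by (simp add: power_mult_distrib power_divide)
  then show "step1 s \<le> 35/16" by (simp add: step1_def)
qed

lemma abs_step2_le: "\<bar>step2 s\<bar> \<le> 27"
proof -
  have "\<bar>420 * s^2 * (1-s)^2 * (1-2 * s)\<bar> \<le> 27" if "0 \<le> s" "s \<le> 1"
  proof -
    have "(s * (1-s))^2 \<le> 1/16"
      using power_mono[OF unit_interval_product(2,1)[OF that], of 2] by (simp add: power_divide)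
    moreover have "\<bar>1 - 2 * s\<bar> \<le> 1" using that by auto
    ultimately have "(s * (1-s))^2 * \<bar>1-2 * s\<bar> \<le> 1/16 * 1"
      by (intro mult_mono) auto
    moreover have "\<bar>420 * s^2 * (1-s)^2 * (1-2 * s)\<bar> = 420 * ((s * (1-s))^2 * \<bar>1-2 * s\<bar>)"
      by (simp add: abs_mult power_mult_distrib)
    ultimately show ?thesis by linarith
  qed
  then show ?thesis by (simp add: step2_def)
qed

lemma abs_step3_le: "\<bar>step3 s\<bar> \<le> 210"
proof -
  have "\<bar>840 * s * (1-s) * (1-5 * s*(1-s))\<bar> \<le> 210" if "0 \<le> s" "s \<le> 1"
  proof -
    note b = unit_interval_product[OF that]
    have "\<bar>1 - 5*(s*(1-s))\<bar> \<le> 1" using b unfolding abs_le_iff by linarith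
    then have "(s * (1-s)) * \<bar>1-5*(s*(1-s))\<bar> \<le> 1/4 * 1"
      by (intro mult_mono) (use b in auto)
    moreover have "\<bar>840 * s * (1-s) * (1-5 * s*(1-s))\<bar> = 840 * ((s * (1-s)) * \<bar>1-5*(s*(1-s))\<bar>)"
      using that by (simp add: abs_mult mult.assoc)
    ultimately show ?thesis by simp
  qed
  then show ?thesis by (simp add: step3_def)
qed

lemma step_nonpos:
  assumes "s \<le> 0"
  shows "step_int s = 0" "step0 s = 0" "step1 s = 0" "step2 s = 0" "step3 s = 0"
  using assms by (auto simp: step_int_def step0_def step1_def step2_def step3_def)

lemma step_ge_1:
  assumes "1 \<le> s"
  shows "step_int s = s - 1/2" "step0 s = 1" "step1 s = 0" "step2 s = 0" "step3 s = 0"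
  using assms
  by (cases "s = 1"; auto simp: step_int_def step0_def step1_def step2_def step3_def)+

lemma mono_step0: "mono step0"
  by (rule monoI, rule DERIV_nonneg_imp_nondecreasing)
    (use DERIV_step0 step1_bounds(1) in blast)+

lemma step0_bounds: "0 \<le> step0 s" "step0 s \<le> 1"
proof -
  have "step0 (min s 0) \<le> step0 s" "step0 s \<le> step0 (max s 1)"
    using mono_step0 by (auto simp: mono_def)
  then show "0 \<le> step0 s" "step0 s \<le> 1"
    by (simp_all add: step_nonpos step_ge_1)
qed

lemmas DERIV_step_chain [derivative_intros] =
  DERIV_step_int[THEN DERIV_chain2] DERIV_step0[THEN DERIV_chain2]
  DERIV_step1[THEN DERIV_chain2] DERIV_step2[THEN DERIV_chain2]

lemma continuous_on_step [continuous_intros]: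
  assumes "continuous_on A f"
  shows "continuous_on A (\<lambda>x. step0 (f x))" "continuous_on A (\<lambda>x. step1 (f x))"
    "continuous_on A (\<lambda>x. step2 (f x))" "continuous_on A (\<lambda>x. step3 (f x))"
    "continuous_on A (\<lambda>x. step_int (f x))"
proof -
  have "continuous_on UNIV step0" "continuous_on UNIV step1"
    "continuous_on UNIV step2" "continuous_on UNIV step_int"
    by (meson DERIV_step0 DERIV_step1 DERIV_step2 DERIV_step_int DERIV_isCont continuous_at_imp_continuous_on)+
  note this[THEN continuous_on_compose2, OF assms] continuous_on_compose2[OF continuous_step3 assms]
  then show "continuous_on A (\<lambda>x. step0 (f x))" "continuous_on A (\<lambda>x. step1 (f x))"
    "continuous_on A (\<lambda>x. step2 (f x))" "continuous_on A (\<lambda>x. step3 (f x))"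
    "continuous_on A (\<lambda>x. step_int (f x))"
    by auto
qed

section \<open>Gluing in time\<close>

text \<open>Derivatives and continuity on all of space-time; \<open>is_pd\<close> and \<open>cont3\<close> only see
  \<open>t \<ge> 0\<close>.\<close>

definition full_pd :: "nat \<Rightarrow> fn3 \<Rightarrow> fn3 \<Rightarrow> bool" where
  "full_pd i f g \<longleftrightarrow> (\<forall>x y t.
     if i = 0 then ((\<lambda>s. f s y t) has_real_derivative g x y t) (at x)
     else if i = 1 then ((\<lambda>s. f x s t) has_real_derivative g x y t) (at y)
     else ((\<lambda>s. f x y s) has_real_derivative g x y t) (at t))"

definition full_cont :: "fn3 \<Rightarrow> bool" where
  "full_cont f \<longleftrightarrow> continuous_on UNIV (\<lambda>(x, y, t). f x y t)"

text \<open>For negative t, \<open>nat\<close> gives index 0, so \<open>F 0\<close> continues the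
  function to the left and a one-sided derivative at t = 0 is the restriction of a two-sided
  one.\<close>

definition glue :: "(nat \<Rightarrow> fn3) \<Rightarrow> fn3" where
  "glue F x y t = F (nat \<lfloor>t / 6\<rfloor>) x y t"

text \<open>Neighbours agree on an open set of times around the joint, not just at the joint;
  differentiability and continuity then become local questions about a single
  \<open>F n\<close>.\<close>

definition compatible :: "(nat \<Rightarrow> fn3) \<Rightarrow> bool" where
  "compatible F \<longleftrightarrow> (\<forall>n x y t. \<bar>t - 6 * real (Suc n)\<bar> < 1 \<longrightarrow> F n x y t = F (Suc n) x y t)"

lemma glue_index_bounds:
  assumes "0 \<le> t"
  shows "6 * real (nat \<lfloor>t / 6\<rfloor>) \<le> t" "t < 6 * real (nat \<lfloor>t / 6\<rfloor>) + 6"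
  using assms by (simp_all, linarith+)

lemma glue_eq:
  assumes F: "compatible F" and t: "6 * real n - 1 < t" "t < 6 * real n + 7"
  shows "glue F x y t = F n x y t"
proof -
  have *: "nat \<lfloor>t / 6\<rfloor> = m" if "6 * real m \<le> t" "t < 6 * real m + 6" for m
  proof -
    have "\<lfloor>t / 6\<rfloor> = int m" using that by (simp add: floor_eq_iff)
    then show ?thesis by simp
  qed
  consider "t < 6 * real n" "n = 0" | "t < 6 * real n" "n > 0"
    | "6 * real n \<le> t" "t < 6 * real n + 6" | "6 * real n + 6 \<le> t" by fastforce
  then show ?thesis
  proof cases
    case 1
    then have "\<lfloor>t / 6\<rfloor> \<le> 0" by (simp add: floor_le_iff)
    then show ?thesis using 1 by (simp add: glue_def)
  next
    case 2
    then obtain m where m: "n = Suc m" by (cases n) auto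
    then have "nat \<lfloor>t / 6\<rfloor> = m" using 2 t by (intro *) auto
    moreover have "\<bar>t - 6 * real (Suc m)\<bar> < 1" using 2 t m by auto
    ultimately show ?thesis using F unfolding compatible_def glue_def m by metis
  next
    case 3
    then show ?thesis by (simp add: glue_def *)
  next
    case 4
    then have "nat \<lfloor>t / 6\<rfloor> = Suc n" using t by (intro *) auto
    moreover have "\<bar>t - 6 * real (Suc n)\<bar> < 1" using 4 t by auto
    ultimately show ?thesis using F unfolding compatible_def glue_def by metis
  qed
qed

lemma glue_eq_near:
  assumes "compatible F" "0 \<le> t" "s \<in> {t - 1<..<t + 1}"
  shows "glue F x y s = F (nat \<lfloor>t / 6\<rfloor>) x y s"
  using glue_index_bounds[OF assms(2)] assms(3) by (intro glue_eq[OF assms(1)]) auto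

lemma is_pd_glue:
  assumes F: "compatible F" and pd: "\<And>n. full_pd i (F n) (G n)"
  shows "is_pd i (glue F) (glue G)"
  unfolding is_pd_def
proof (intro allI impI)
  fix x y t :: real assume t: "0 \<le> t"
  define n where "n = nat \<lfloor>t / 6\<rfloor>"
  have n: "\<And>x y s. s \<in> {t - 1<..<t + 1} \<Longrightarrow> glue F x y s = F n x y s"
    "\<And>F x y. glue F x y t = F n x y t"
    unfolding n_def using glue_eq_near[OF F t] by (simp_all add: glue_def)
  \<comment> \<open>Only the time derivative looks beyond the instant t; for the spatial ones,
    \<open>glue F\<close> and \<open>F n\<close> are the same function.\<close>
  have "((\<lambda>s. glue F x y s) has_real_derivative G n x y t) (at t within {0..})"
    if "((\<lambda>s. F n x y s) has_real_derivative G n x y t) (at t)"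
    using has_field_derivative_transform_within_open[OF that, of "{t - 1<..<t + 1}"] n(1)
    by (auto intro: has_field_derivative_at_within)
  then show "if i = 0 then ((\<lambda>s. glue F s y t) has_real_derivative glue G x y t) (at x)
    else if i = 1 then ((\<lambda>s. glue F x s t) has_real_derivative glue G x y t) (at y)
    else ((\<lambda>s. glue F x y s) has_real_derivative glue G x y t) (at t within {0..})"
    using pd[of n] unfolding full_pd_def n(2) by (auto split: if_splits)
qed

text \<open>Functions that agree on an open interval of times have the same derivatives there. Hence
  compatibility has to be verified by formulas only for the solution and the matrix, and all
  derivative families inherit it.\<close>

lemma compatible_pd:
  assumes F: "compatible F" and pd: "\<And>n. full_pd i (F n) (G n)"
  shows "compatible G"
  unfolding compatible_def
proof (intro allI impI)
  fix n and x y t :: real assume t: "\<bar>t - 6 * real (Suc n)\<bar> < 1"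
  have eq: "F n x y s = F (Suc n) x y s" if "\<bar>s - 6 * real (Suc n)\<bar> < 1" for x y s
    using F that unfolding compatible_def by blast
  have "((\<lambda>s. F (Suc n) x y s) has_real_derivative D) (at t)"
    if "((\<lambda>s. F n x y s) has_real_derivative D) (at t)" for D
    by (rule has_field_derivative_transform_within_open[OF that, of "{6 * real (Suc n) - 1<..<6 * real (Suc n) + 1}"])
      (use t eq in \<open>auto simp: abs_less_iff\<close>)
  note * = this
  note pd' = pd[unfolded full_pd_def, THEN spec[of _ x], THEN spec[of _ y], THEN spec[of _ t]]
  consider "i = 0" | "i = 1" | "i \<noteq> 0" "i \<noteq> 1" by blast
  then show "G n x y t = G (Suc n) x y t"
  proof cases
    case 1
    then show ?thesis using pd'[of n] pd'[of "Suc n"] eq[OF t] by (simp add: DERIV_unique)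
  next
    case 2
    then show ?thesis using pd'[of n] pd'[of "Suc n"] eq[OF t] by (simp add: DERIV_unique)
  next
    case 3
    then have "((\<lambda>s. F n x y s) has_real_derivative G n x y t) (at t)"
      "((\<lambda>s. F (Suc n) x y s) has_real_derivative G (Suc n) x y t) (at t)"
      using pd'[of n] pd'[of "Suc n"] by simp_all
    then show ?thesis using * DERIV_unique by blast
  qed
qed

lemma cont3_glue:
  assumes F: "compatible F" and cont: "\<And>n. full_cont (F n)"
  shows "cont3 (glue F)"
  unfolding cont3_def
proof (rule continuous_at_imp_continuous_on, rule ballI)
  fix z :: "real \<times> real \<times> real" assume "z \<in> UNIV \<times> UNIV \<times> {0..}"
  then obtain x y t where z: "z = (x, y, t)" "0 \<le> t" by auto
  define n where "n = nat \<lfloor>t / 6\<rfloor>"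
  have n: "\<And>x y s. s \<in> {t - 1<..<t + 1} \<Longrightarrow> glue F x y s = F n x y s"
    unfolding n_def by (rule glue_eq_near[OF F z(2)])
  have op: "open (UNIV \<times> UNIV \<times> {t - 1<..<t + 1} :: (real \<times> real \<times> real) set)"
    by (intro open_Times) auto
  have "eventually (\<lambda>w. w \<in> UNIV \<times> UNIV \<times> {t - 1<..<t + 1}) (nhds z)"
    by (rule eventually_nhds_in_open[OF op]) (simp add: z)
  then have "eventually (\<lambda>w. (case w of (x, y, t) \<Rightarrow> glue F x y t) = (case w of (x, y, t) \<Rightarrow> F n x y t)) (nhds z)"
    by eventually_elim (auto simp: n)
  moreover have "isCont (\<lambda>(x, y, t). F n x y t) z"
    using cont[of n] unfolding full_cont_def by (auto simp: z continuous_on_eq_continuous_at)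
  ultimately show "isCont (\<lambda>(x, y, t). glue F x y t) z"
    by (simp only: isCont_cong)
qed

lemma glue_abs_le:
  assumes "0 \<le> t"
    and "\<And>n x y t. \<lbrakk>6 * real n \<le> t; t \<le> 6 * real n + 6\<rbrakk> \<Longrightarrow> \<bar>F n x y t\<bar> \<le> B"
  shows "\<bar>glue F x y t\<bar> \<le> B"
  using glue_index_bounds[OF assms(1)] assms(2) unfolding glue_def by (meson less_imp_le)

section \<open>Two coupled modes\<close>

definition wave :: "real \<Rightarrow> real \<Rightarrow> (real \<Rightarrow> real) \<Rightarrow> (real \<Rightarrow> real) \<Rightarrow> fn3" where
  "wave p q P Q x y t = P t * cos (p * x) + Q t * cos (q * y)"

definition wave_x :: "real \<Rightarrow> (real \<Rightarrow> real) \<Rightarrow> fn3" where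
  "wave_x p P x y t = - p * P t * sin (p * x)"

definition wave_y :: "real \<Rightarrow> (real \<Rightarrow> real) \<Rightarrow> fn3" where
  "wave_y q Q x y t = - q * Q t * sin (q * y)"

definition wave_grad where
  "wave_grad p q P P1 Q Q1 i =
     (if i = 0 then wave_x p P else if i = 1 then wave_y q Q else wave p q P1 Q1)"

definition wave_hess where
  "wave_hess p q P P1 P2 Q Q1 Q2 i j =
     (if i = 0 then (if j = 0 then wave p q (\<lambda>t. - (p^2) * P t) (\<lambda>t. 0)
        else if j = 1 then (\<lambda>x y t. 0) else wave_x p P1)
      else if i = 1 then (if j = 0 then (\<lambda>x y t. 0)
        else if j = 1 then wave p q (\<lambda>t. 0) (\<lambda>t. - (q^2) * Q t) else wave_y q Q1)
      else wave_grad p q P1 P2 Q1 Q2 j)"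

lemma full_pd_wave:
  assumes "\<And>t. (P has_real_derivative P1 t) (at t)" "\<And>t. (Q has_real_derivative Q1 t) (at t)"
  shows "full_pd i (wave p q P Q) (wave_grad p q P P1 Q Q1 i)"
  unfolding full_pd_def wave_grad_def wave_def wave_x_def wave_y_def
  by (auto intro!: derivative_eq_intros assms)

lemma full_pd_wave_grad:
  assumes "\<And>t. (P has_real_derivative P1 t) (at t)" "\<And>t. (Q has_real_derivative Q1 t) (at t)"
    "\<And>t. (P1 has_real_derivative P2 t) (at t)" "\<And>t. (Q1 has_real_derivative Q2 t) (at t)"
  shows "full_pd j (wave_grad p q P P1 Q Q1 i) (wave_hess p q P P1 P2 Q Q1 Q2 i j)"
proof -
  have "full_pd j (wave_x p P) (wave_hess p q P P1 P2 Q Q1 Q2 0 j)"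
    "full_pd j (wave_y q Q) (wave_hess p q P P1 P2 Q Q1 Q2 (Suc 0) j)"
    unfolding full_pd_def wave_hess_def wave_def wave_x_def wave_y_def
    by (auto intro!: derivative_eq_intros assms simp: power2_eq_square)
  then show ?thesis
    using full_pd_wave[OF assms(3,4), of j p q] by (auto simp: wave_grad_def wave_hess_def)
qed

lemma full_cont_wave_x:
  assumes "continuous_on UNIV P"
  shows "full_cont (wave_x p P)"
  unfolding full_cont_def wave_x_def case_prod_beta
  by (intro continuous_intros continuous_on_compose2[OF assms(1)]; simp)

lemma full_cont_wave_y:
  assumes "continuous_on UNIV Q"
  shows "full_cont (wave_y q Q)"
  unfolding full_cont_def wave_y_def case_prod_beta
  by (intro continuous_intros continuous_on_compose2[OF assms(1)]; simp)

lemma full_cont_wave: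
  assumes "continuous_on UNIV P" "continuous_on UNIV Q"
  shows "full_cont (wave p q P Q)"
  unfolding full_cont_def wave_def case_prod_beta
  by (intro continuous_intros continuous_on_compose2[OF assms(1)] continuous_on_compose2[OF assms(2)]; simp)

lemma full_cont_wave_grad:
  assumes "continuous_on UNIV P" "continuous_on UNIV P1" "continuous_on UNIV Q" "continuous_on UNIV Q1"
  shows "full_cont (wave_grad p q P P1 Q Q1 i)"
  unfolding wave_grad_def using assms by (simp add: full_cont_wave full_cont_wave_x full_cont_wave_y)

lemma full_cont_wave_hess:
  assumes "continuous_on UNIV P" "continuous_on UNIV P1" "continuous_on UNIV P2"
    "continuous_on UNIV Q" "continuous_on UNIV Q1" "continuous_on UNIV Q2"
  shows "full_cont (wave_hess p q P P1 P2 Q Q1 Q2 i j)"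
proof -
  have "full_cont (\<lambda>x y t. 0)" by (simp add: full_cont_def)
  moreover have "full_cont (wave p q (\<lambda>t. - (p^2) * P t) (\<lambda>t. 0))" "full_cont (wave p q (\<lambda>t. 0) (\<lambda>t. - (q^2) * Q t))"
    by (intro full_cont_wave continuous_intros assms)+
  ultimately show ?thesis
    unfolding wave_hess_def
    using full_cont_wave_grad[OF assms(2,3,5,6)] full_cont_wave_x[OF assms(2)] full_cont_wave_y[OF assms(5)]
    by (cases "i = 0"; cases "i = 1"; cases "j = 0"; cases "j = 1"; simp)
qed

lemma sum_lessThan_2: "(\<Sum>i<2::nat. f i) = f 0 + f (Suc 0)"
  by (simp add: numeral_2_eq_2)

text \<open>All four matrix entries share this separated form, which is closed under
  differentiation; derivatives, continuity and size can thus be treated once.\<close>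

definition entry :: "(real \<Rightarrow> real) \<Rightarrow> (real \<Rightarrow> real) \<Rightarrow> (real \<Rightarrow> real) \<Rightarrow> (real \<Rightarrow> real) \<Rightarrow> fn3" where
  "entry a r \<phi> \<psi> x y t = a t + r t * \<phi> x * \<psi> y"

text \<open>\<open>r1\<close> is the rate at which the mode \<open>cos (p x)\<close> feeds the mode \<open>cos (q y)\<close>, acting through the first
  column only; \<open>r2\<close> is the converse rate, in the second column.\<close>

definition coupling :: "real \<Rightarrow> real \<Rightarrow> (real \<Rightarrow> real) \<Rightarrow> (real \<Rightarrow> real) \<Rightarrow> (real \<Rightarrow> real) \<Rightarrow> (real \<Rightarrow> real)
    \<Rightarrow> nat \<Rightarrow> nat \<Rightarrow> fn3" where
  "coupling p q a b r1 r2 i j =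
     (if i = 0 then
       (if j = 0 then entry a (\<lambda>t. - r1 t / p^2) (\<lambda>x. cos (p * x)) (\<lambda>y. cos (q * y))
        else entry (\<lambda>t. 0) (\<lambda>t. - 2 * r2 t / (p * q)) (\<lambda>x. sin (p * x)) (\<lambda>y. sin (q * y)))
      else
       (if j = 0 then entry (\<lambda>t. 0) (\<lambda>t. - 2 * r1 t / (p * q)) (\<lambda>x. sin (p * x)) (\<lambda>y. sin (q * y))
        else entry b (\<lambda>t. - r2 t / q^2) (\<lambda>x. cos (p * x)) (\<lambda>y. cos (q * y))))"

definition flux where
  "flux p q a b r1 r2 P Q i x y t =
     (\<Sum>j<2::nat. coupling p q a b r1 r2 i j x y t * wave_grad p q P P Q Q j x y t)"

definition flux_deriv :: "real \<Rightarrow> real \<Rightarrow> (real \<Rightarrow> real) \<Rightarrow> (real \<Rightarrow> real) \<Rightarrow> (real \<Rightarrow> real) \<Rightarrow> (real \<Rightarrow> real)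
    \<Rightarrow> (real \<Rightarrow> real) \<Rightarrow> (real \<Rightarrow> real) \<Rightarrow> nat \<Rightarrow> fn3" where
  "flux_deriv p q a b r1 r2 P Q i x y t =
     (if i = 0 then - a t * p^2 * P t * cos (p * x)
         + r1 t * P t * (cos (p * x)^2 - sin (p * x)^2) * cos (q * y)
         + 2 * r2 t * Q t * cos (p * x) * sin (q * y)^2
      else - b t * q^2 * Q t * cos (q * y)
         + r2 t * Q t * (cos (q * y)^2 - sin (q * y)^2) * cos (p * x)
         + 2 * r1 t * P t * cos (q * y) * sin (p * x)^2)"

lemma full_pd_flux:
  assumes "p \<noteq> 0" "q \<noteq> 0" "i < 2"
  shows "full_pd i (flux p q a b r1 r2 P Q i) (flux_deriv p q a b r1 r2 P Q i)"
proof -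
  \<comment> \<open>Both flux components are of this type, with k = p in the variable x and k = q in
    the variable y; \<open>v\<close> and \<open>w\<close> collect the factors in the other
    variable.\<close>
  have d: "((\<lambda>s. - \<alpha> * k * P * sin (k * s) + r * P / k * (sin (k * s) * cos (k * s)) * v
      + 2 * r' * Q / k * sin (k * s) * w) has_real_derivative
      - \<alpha> * k^2 * P * cos (k * s) + r * P * (cos (k * s)^2 - sin (k * s)^2) * v
      + 2 * r' * Q * cos (k * s) * w) (at s)"
    if "k \<noteq> 0" for \<alpha> k P Q r r' v w s :: real
  proof -
    have "((\<lambda>s. sin (k * s)) has_real_derivative k * cos (k * s)) (at s)"
      "((\<lambda>s. sin (k * s) * cos (k * s)) has_real_derivative
        k * (cos (k * s)^2 - sin (k * s)^2)) (at s)"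
      by (auto intro!: derivative_eq_intros simp: algebra_simps power2_eq_square)
    note DERIV_add[OF DERIV_add[OF DERIV_cmult[OF this(1), of "- \<alpha> * k * P"]
        DERIV_cmult_right[OF DERIV_cmult[OF this(2), of "r * P / k"], of v]]
        DERIV_cmult_right[OF DERIV_cmult[OF this(1), of "2 * r' * Q / k"], of w]]
    then show ?thesis
      by (rule DERIV_cong) (use that in \<open>simp add: power2_eq_square\<close>)
  qed
  have "flux p q a b r1 r2 P Q 0 x y t = - a t * p * P t * sin (p * x)
      + r1 t * P t / p * (sin (p * x) * cos (p * x)) * cos (q * y)
      + 2 * r2 t * Q t / p * sin (p * x) * sin (q * y)^2" for x y t
    unfolding flux_def sum_lessThan_2 coupling_def wave_grad_def wave_x_def wave_y_def entry_def
    using assms(1,2) by (simp add: divide_simps) (simp add: algebra_simps power2_eq_square)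
  note eq0 = this
  have 0: "full_pd 0 (flux p q a b r1 r2 P Q 0) (flux_deriv p q a b r1 r2 P Q 0)"
    unfolding full_pd_def flux_deriv_def eq0
    by (simp only: refl if_True if_False one_neq_zero) (intro allI d assms)
  have "flux p q a b r1 r2 P Q 1 x y t = - b t * q * Q t * sin (q * y)
      + r2 t * Q t / q * (sin (q * y) * cos (q * y)) * cos (p * x)
      + 2 * r1 t * P t / q * sin (q * y) * sin (p * x)^2" for x y t
    unfolding flux_def sum_lessThan_2 coupling_def wave_grad_def wave_x_def wave_y_def entry_def
    using assms(1,2) by (simp add: divide_simps) (simp add: algebra_simps power2_eq_square)
  note eq1 = this
  have 1: "full_pd 1 (flux p q a b r1 r2 P Q 1) (flux_deriv p q a b r1 r2 P Q 1)"
    unfolding full_pd_def flux_deriv_def eq1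
    by (simp only: refl if_True if_False one_neq_zero) (intro allI d assms)
  have "i = 0 \<or> i = 1" using assms(3) by auto
  then show ?thesis using 0 1 by blast
qed

text \<open>The two \<open>r1\<close> terms of the divergence add up through cos^2 - sin^2 + 2 sin^2
  = 1 to \<open>r1 t * P t * cos (q * y)\<close>, and likewise for \<open>r2\<close>. No other
  harmonics remain, so the equation splits into the two ordinary differential equations assumed
  here.\<close>

lemma wave_equation:
  assumes "P2 t = a t * p^2 * P t - r2 t * Q t" "Q2 t = b t * q^2 * Q t - r1 t * P t"
  shows "wave p q P2 Q2 x y t + (\<Sum>i<2. flux_deriv p q a b r1 r2 P Q i x y t) = 0"
proof -
  have c: "cos (p * x)^2 = 1 - sin (p * x)^2" "cos (q * y)^2 = 1 - sin (q * y)^2"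
    by (simp_all add: cos_squared_eq)
  then show ?thesis
    unfolding wave_def assms sum_lessThan_2 flux_deriv_def c by (simp add: algebra_simps)
qed

section \<open>Regularity and size of the coefficient matrix\<close>

lemma full_cont_coupling:
  assumes "continuous_on UNIV a" "continuous_on UNIV b" "continuous_on UNIV r1" "continuous_on UNIV r2"
  shows "full_cont (coupling p q a b r1 r2 i j)"
  \<comment> \<open>As multiplications by a constant inverse, the divisions raise no nonvanishing
    conditions.\<close>
  unfolding full_cont_def coupling_def entry_def case_prod_beta divide_inverse
  by (cases "i = 0"; cases "j = 0";
      simp del: mult_minus_left mult_minus_right minus_mult_left minus_mult_right;
      intro continuous_intros continuous_on_compose2[OF assms(1)] continuous_on_compose2[OF assms(2)]
        continuous_on_compose2[OF assms(3)] continuous_on_compose2[OF assms(4)]; simp)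

definition coupling_grad where
  "coupling_grad p q a' b' r1 r2 r1' r2' i j k =
     (let d = \<lambda>a' r r' \<phi> \<phi>' \<psi> \<psi>'.
        (if k = 0 then entry (\<lambda>t. 0) r \<phi>' \<psi> else if k = Suc 0 then entry (\<lambda>t. 0) r \<phi> \<psi>' else entry a' r' \<phi> \<psi>);
       cc = \<lambda>a' r r'. d a' r r' (\<lambda>x. cos (p * x)) (\<lambda>x. - p * sin (p * x)) (\<lambda>y. cos (q * y)) (\<lambda>y. - q * sin (q * y));
       ss = \<lambda>r r'. d (\<lambda>t. 0) r r' (\<lambda>x. sin (p * x)) (\<lambda>x. p * cos (p * x)) (\<lambda>y. sin (q * y)) (\<lambda>y. q * cos (q * y))
      in if i = 0 then
          (if j = 0 then cc a' (\<lambda>t. - r1 t / p^2) (\<lambda>t. - r1' t / p^2)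
           else ss (\<lambda>t. - 2 * r2 t / (p * q)) (\<lambda>t. - 2 * r2' t / (p * q)))
         else
          (if j = 0 then ss (\<lambda>t. - 2 * r1 t / (p * q)) (\<lambda>t. - 2 * r1' t / (p * q))
           else cc b' (\<lambda>t. - r2 t / q^2) (\<lambda>t. - r2' t / q^2)))"

lemma full_pd_entry:
  assumes "\<And>t. (a has_real_derivative a' t) (at t)" "\<And>t. (r has_real_derivative r' t) (at t)"
    and "\<And>x. (\<phi> has_real_derivative \<phi>' x) (at x)" "\<And>y. (\<psi> has_real_derivative \<psi>' y) (at y)"
  shows "full_pd k (entry a r \<phi> \<psi>)
    (if k = 0 then entry (\<lambda>t. 0) r \<phi>' \<psi> else if k = Suc 0 then entry (\<lambda>t. 0) r \<phi> \<psi>' else entry a' r' \<phi> \<psi>)"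
  unfolding full_pd_def entry_def
  by (auto intro!: derivative_eq_intros assms)

lemma full_pd_coupling:
  assumes "\<And>t. (a has_real_derivative a' t) (at t)" "\<And>t. (b has_real_derivative b' t) (at t)"
    and r: "\<And>t. (r1 has_real_derivative r1' t) (at t)" "\<And>t. (r2 has_real_derivative r2' t) (at t)"
  shows "full_pd k (coupling p q a b r1 r2 i j) (coupling_grad p q a' b' r1 r2 r1' r2' i j k)"
proof -
  have trig: "((\<lambda>x. cos (p * x)) has_real_derivative - p * sin (p * x)) (at x)"
    "((\<lambda>x. sin (p * x)) has_real_derivative p * cos (p * x)) (at x)" for p x :: real
    by (auto intro!: derivative_eq_intros)
  have sc: "((\<lambda>t. - r1 t / c) has_real_derivative - r1' t / c) (at t)"
    "((\<lambda>t. - r2 t / c) has_real_derivative - r2' t / c) (at t)"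
    "((\<lambda>t. - 2 * r1 t / c) has_real_derivative - 2 * r1' t / c) (at t)"
    "((\<lambda>t. - 2 * r2 t / c) has_real_derivative - 2 * r2' t / c) (at t)" for c t
    by (intro DERIV_cdivide DERIV_minus DERIV_cmult r)+
  have z: "((\<lambda>t. 0) has_real_derivative 0) (at t)" for t :: real by simp
  show ?thesis
    unfolding coupling_def coupling_grad_def Let_def
    by (cases "i = 0"; cases "j = 0"; simp only: if_True if_False refl;
        intro full_pd_entry assms trig sc z)
qed

lemma full_cont_coupling_grad:
  assumes "continuous_on UNIV a'" "continuous_on UNIV b'" "continuous_on UNIV r1" "continuous_on UNIV r2"
    "continuous_on UNIV r1'" "continuous_on UNIV r2'"
  shows "full_cont (coupling_grad p q a' b' r1 r2 r1' r2' i j k)"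
proof -
  have e: "full_cont (entry a r \<phi> \<psi>)"
    if "continuous_on UNIV a" "continuous_on UNIV r" "continuous_on UNIV \<phi>" "continuous_on UNIV \<psi>" for a r \<phi> \<psi>
    unfolding full_cont_def entry_def case_prod_beta
    by (intro continuous_intros continuous_on_compose2[OF that(1)] continuous_on_compose2[OF that(2)]
        continuous_on_compose2[OF that(3)] continuous_on_compose2[OF that(4)]; simp)
  show ?thesis
    unfolding coupling_grad_def Let_def divide_inverse
    by (cases "i = 0"; cases "j = 0"; cases "k = 0"; cases "k = Suc 0"; simp only: if_True if_False refl;
        intro e continuous_intros assms)
qed

lemma entry_abs_le:
  assumes "\<bar>r t\<bar> \<le> R" "\<bar>\<phi> x\<bar> \<le> F" "\<bar>\<psi> y\<bar> \<le> G"
  shows "\<bar>entry a r \<phi> \<psi> x y t - a t\<bar> \<le> R * F * G"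
proof -
  have "\<bar>r t\<bar> * \<bar>\<phi> x\<bar> * \<bar>\<psi> y\<bar> \<le> R * F * G"
    by (intro mult_mono assms mult_nonneg_nonneg) (use assms abs_ge_zero order_trans in blast)+
  then show ?thesis by (simp add: entry_def abs_mult)
qed

text \<open>A rate of order k yields a matrix perturbation of order 1/k; the factor 2 comes from the
  off-diagonal entries. It serves with \<open>c\<close> = 5 for the rates and \<open>c\<close> = 100
  for their time derivatives.\<close>

lemma coupling_coefficient_le:
  fixes k p q r c :: real
  assumes "0 < k" "k \<le> p" "k \<le> q" "\<bar>r\<bar> \<le> c * k"
  shows "\<bar>- r / p^2\<bar> \<le> 2 * c / k" "\<bar>- 2 * r / (p * q)\<bar> \<le> 2 * c / k"
proof -
  have c: "0 \<le> c * k" using assms(4) by linarith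
  have "k * k \<le> p * p" "k * k \<le> p * q" using assms by (auto intro!: mult_mono)
  moreover have "\<bar>r\<bar> / (p * p) \<le> c * k / (k * k)" "\<bar>r\<bar> / (p * q) \<le> c * k / (k * k)"
    by (rule frac_le[OF c assms(4)]; use assms calculation in simp)+
  moreover have "c * k / (k * k) = c / k" "c / k \<le> 2 * c / k"
    using c assms(1) by (auto simp: zero_le_mult_iff divide_right_mono)
  moreover have "2 * (\<bar>r\<bar> / (p * q)) \<le> 2 * (c * k / (k * k))" using calculation by linarith
  moreover have "0 \<le> c" using c assms(1) by (simp add: zero_le_mult_iff)
  ultimately show "\<bar>- r / p^2\<bar> \<le> 2 * c / k" "\<bar>- 2 * r / (p * q)\<bar> \<le> 2 * c / k"
    using assms by (auto simp: power2_eq_square abs_mult)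
qed

lemma coupling_near_diagonal:
  assumes "1000 \<le> k" "k \<le> p" "k \<le> q" "\<bar>r1 t\<bar> \<le> 5 * k" "\<bar>r2 t\<bar> \<le> 5 * k"
  shows "\<bar>coupling p q a b r1 r2 i j x y t - (if i = 0 \<and> j = 0 then a t else if i = 0 \<or> j = 0 then 0 else b t)\<bar>
    \<le> 1/100"
proof -
  \<comment> \<open>The threshold 1000 for k originates here.\<close>
  have k: "0 < k" "2 * 5 / k * 1 * 1 \<le> 1/100" using assms(1) by (auto simp: divide_simps)
  note c = coupling_coefficient_le[OF k(1) assms(2,3,4)] coupling_coefficient_le[OF k(1) assms(2,3,5)]
    coupling_coefficient_le[OF k(1) assms(3,3,5)]
  have e: "\<bar>entry \<alpha> r \<phi> \<psi> x y t - \<alpha> t\<bar> \<le> 1/100"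
    if "\<bar>r t\<bar> \<le> 2 * 5 / k" "\<bar>\<phi> x\<bar> \<le> 1" "\<bar>\<psi> y\<bar> \<le> 1" for \<alpha> r \<phi> \<psi>
    using entry_abs_le[of r t _ \<phi> x _ \<psi> y _ \<alpha>, OF that] k(2) by (rule order_trans)
  show ?thesis
    unfolding coupling_def
    by (cases "i = 0"; cases "j = 0"; simp only: if_True if_False refl simp_thms;
        rule e; (rule c abs_cos_le_one abs_sin_le_one)+)
qed

text \<open>A spatial derivative costs a factor of at most 2k, giving 10/k times 2k = 20. A time
  derivative is at most 5 from the diagonal part plus 200/k from the perturbation. So 60 leaves
  ample room.\<close>

lemma coupling_grad_le:
  assumes k: "1000 \<le> k" "k \<le> p" "p \<le> 2 * k" "k \<le> q" "q \<le> 2 * k"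
    and r: "\<bar>r1 t\<bar> \<le> 5 * k" "\<bar>r2 t\<bar> \<le> 5 * k" "\<bar>r1' t\<bar> \<le> 100 * k" "\<bar>r2' t\<bar> \<le> 100 * k"
    and ab: "\<bar>a' t\<bar> \<le> 5" "\<bar>b' t\<bar> \<le> 5"
  shows "\<bar>coupling_grad p q a' b' r1 r2 r1' r2' i j l x y t\<bar> \<le> 60"
proof -
  have k0: "0 < k" using k by simp
  have trig: "\<bar>- p * sin z\<bar> \<le> 2 * k" "\<bar>p * cos z\<bar> \<le> 2 * k" if "k \<le> p" "p \<le> 2 * k" for p z :: real
  proof -
    have "\<bar>p\<bar> * \<bar>sin z\<bar> \<le> 2 * k * 1" "\<bar>p\<bar> * \<bar>cos z\<bar> \<le> 2 * k * 1"
      using that k0 by (intro mult_mono; simp)+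
    then show "\<bar>- p * sin z\<bar> \<le> 2 * k" "\<bar>p * cos z\<bar> \<le> 2 * k" by (simp_all add: abs_mult)
  qed
  have e: "\<bar>(if l = 0 then entry (\<lambda>t. 0) \<rho> \<phi>' \<psi> else if l = Suc 0 then entry (\<lambda>t. 0) \<rho> \<phi> \<psi>'
      else entry \<alpha> \<rho>' \<phi> \<psi>) x y t\<bar> \<le> 60"
    if "\<bar>\<alpha> t\<bar> \<le> 5" "\<bar>\<rho> t\<bar> \<le> 2 * 5 / k" "\<bar>\<rho>' t\<bar> \<le> 2 * 100 / k" "\<bar>\<phi> x\<bar> \<le> 1" "\<bar>\<psi> y\<bar> \<le> 1"
      "\<bar>\<phi>' x\<bar> \<le> 2 * k" "\<bar>\<psi>' y\<bar> \<le> 2 * k" for \<alpha> \<rho> \<rho>' \<phi> \<phi>' \<psi> \<psi>'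
  proof -
    have "2 * 5 / k * (2 * k) * 1 = 20" "2 * 5 / k * 1 * (2 * k) = 20" "2 * 100 / k * 1 * 1 \<le> 1"
      using k by (auto simp: divide_simps)
    then show ?thesis
      using entry_abs_le[of \<rho> t _ \<phi>' x _ \<psi> y _ "\<lambda>t. 0", OF that(2,6,5)]
        entry_abs_le[of \<rho> t _ \<phi> x _ \<psi>' y _ "\<lambda>t. 0", OF that(2,4,7)]
        entry_abs_le[of \<rho>' t _ \<phi> x _ \<psi> y _ \<alpha>, OF that(3,4,5)] that(1)
      by auto
  qed
  note c = coupling_coefficient_le[OF k0 k(2,4)] coupling_coefficient_le[OF k0 k(4,4)]
  show ?thesis
    unfolding coupling_grad_def Let_def
    by (cases "i = 0"; cases "j = 0"; simp only: if_True if_False refl;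
        rule e; (rule c r trig k ab abs_cos_le_one abs_sin_le_one | simp)+)
qed

section \<open>One transition\<close>

text \<open>Local time \<open>s\<close> runs through \<open>[0, 6]\<close>. On \<open>[2, 3]\<close> the old mode of frequency \<open>k\<close> feeds the new one
  of frequency \<open>2 k\<close>, on \<open>[3, 4]\<close> the new one extinguishes the old one; meanwhile the coefficient
  \<open>conduct\<close> of the new direction is \<open>1/4\<close>, so that both modes decay like \<open>exp (- k s)\<close>.\<close>

definition phase0 :: "real \<Rightarrow> real" where
  "phase0 s = 2 * s - step_int (s - 1) + step_int (s - 4) - 3/2"
definition phase1 :: "real \<Rightarrow> real" where "phase1 s = 2 - step0 (s - 1) + step0 (s - 4)"
definition phase2 :: "real \<Rightarrow> real" where "phase2 s = step1 (s - 4) - step1 (s - 1)"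
definition phase3 :: "real \<Rightarrow> real" where "phase3 s = step2 (s - 4) - step2 (s - 1)"

text \<open>Solved from the requirement that Q = exp(-k \<open>phase0\<close>) satisfy Q'' =
  \<open>conduct\<close> (2k)^2 Q, where Q''/Q = k^2 \<open>phase1\<close>^2 - k
  \<open>phase2\<close>. Slope 2 of the phase gives the value 1, slope 1 the value 1/4.\<close>

definition conduct :: "real \<Rightarrow> real \<Rightarrow> real" where
  "conduct k s = (phase1 s)^2 / 4 - phase2 s / (4 * k)"
definition conduct' :: "real \<Rightarrow> real \<Rightarrow> real" where
  "conduct' k s = phase1 s * phase2 s / 2 - phase3 s / (4 * k)"

definition old0 :: "real \<Rightarrow> real \<Rightarrow> real" where
  "old0 k s = exp (- k * s) * (1 - step0 (s - 3))"
definition old1 :: "real \<Rightarrow> real \<Rightarrow> real" where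
  "old1 k s = exp (- k * s) * (- k * (1 - step0 (s - 3)) - step1 (s - 3))"
definition old2 :: "real \<Rightarrow> real \<Rightarrow> real" where
  "old2 k s = exp (- k * s) * (k^2 * (1 - step0 (s - 3)) + 2 * k * step1 (s - 3) - step2 (s - 3))"

definition new0 :: "real \<Rightarrow> real \<Rightarrow> real" where
  "new0 k s = exp (- k * phase0 s) * step0 (s - 2)"
definition new1 :: "real \<Rightarrow> real \<Rightarrow> real" where
  "new1 k s = exp (- k * phase0 s) * (step1 (s - 2) - k * phase1 s * step0 (s - 2))"
definition new2 :: "real \<Rightarrow> real \<Rightarrow> real" where
  "new2 k s = exp (- k * phase0 s) * (step2 (s - 2) - 2 * k * phase1 s * step1 (s - 2)
     + (k^2 * (phase1 s)^2 - k * phase2 s) * step0 (s - 2))"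

text \<open>For g = exp(-k s) \<open>step0 (s - 2)\<close> the defect k^2 g - g'' is exp(-k s) times
  this expression; division by the old mode exp(-k s) leaves a rate without exponentials.
  \<open>damp\<close> is the same quotient for the old mode, divided by the new one.\<close>

definition feed :: "real \<Rightarrow> real \<Rightarrow> real" where
  "feed k s = 2 * k * step1 (s - 2) - step2 (s - 2)"
definition feed' :: "real \<Rightarrow> real \<Rightarrow> real" where
  "feed' k s = 2 * k * step2 (s - 2) - step3 (s - 2)"
definition damp :: "real \<Rightarrow> real \<Rightarrow> real" where
  "damp k s = step2 (s - 3) - 2 * k * step1 (s - 3)"
definition damp' :: "real \<Rightarrow> real \<Rightarrow> real" where
  "damp' k s = step3 (s - 3) - 2 * k * step2 (s - 3)"

section \<open>Derivatives, continuity and size of the profiles\<close>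

lemma DERIV_phase [derivative_intros]:
  assumes "(f has_real_derivative f') (at x)"
  shows "((\<lambda>x. phase0 (f x)) has_real_derivative phase1 (f x) * f') (at x)"
    "((\<lambda>x. phase1 (f x)) has_real_derivative phase2 (f x) * f') (at x)"
    "((\<lambda>x. phase2 (f x)) has_real_derivative phase3 (f x) * f') (at x)"
  unfolding phase0_def phase1_def phase2_def phase3_def
  by (auto intro!: derivative_eq_intros assms simp: algebra_simps)

lemma continuous_on_phase [continuous_intros]:
  assumes "continuous_on A f"
  shows "continuous_on A (\<lambda>x. phase0 (f x))" "continuous_on A (\<lambda>x. phase1 (f x))"
    "continuous_on A (\<lambda>x. phase2 (f x))" "continuous_on A (\<lambda>x. phase3 (f x))"
  unfolding phase0_def phase1_def phase2_def phase3_def by (intro continuous_intros assms)+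

lemma DERIV_modes:
  "(old0 k has_real_derivative old1 k s) (at s)" "(old1 k has_real_derivative old2 k s) (at s)"
  "(new0 k has_real_derivative new1 k s) (at s)" "(new1 k has_real_derivative new2 k s) (at s)"
  unfolding old0_def[abs_def] old1_def[abs_def] old2_def new0_def[abs_def] new1_def[abs_def] new2_def
  by (auto intro!: derivative_eq_intros simp: algebra_simps power2_eq_square)

lemma DERIV_coefficients:
  "(feed k has_real_derivative feed' k s) (at s)" "(damp k has_real_derivative damp' k s) (at s)"
  "(conduct k has_real_derivative conduct' k s) (at s)"
proof -
  show "(feed k has_real_derivative feed' k s) (at s)" "(damp k has_real_derivative damp' k s) (at s)"
    unfolding feed_def[abs_def] feed'_def damp_def[abs_def] damp'_def
    by (auto intro!: derivative_eq_intros simp: algebra_simps)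
  have "((\<lambda>s. (phase1 s)^2 / 4 - phase2 s / (4 * k)) has_real_derivative
      (2 * phase1 s * phase2 s) / 4 - phase3 s / (4 * k)) (at s)"
    by (intro DERIV_diff DERIV_cdivide) (auto intro!: derivative_eq_intros)
  then show "(conduct k has_real_derivative conduct' k s) (at s)"
    unfolding conduct_def[abs_def] conduct'_def by simp
qed

lemma continuous_on_profiles:
  "continuous_on UNIV (old2 k)" "continuous_on UNIV (new2 k)" "continuous_on UNIV (feed' k)"
  "continuous_on UNIV (damp' k)" "continuous_on UNIV (conduct' k)"
  unfolding old2_def[abs_def] new2_def[abs_def] feed'_def[abs_def] damp'_def[abs_def] conduct'_def[abs_def]
    divide_inverse
  by (intro continuous_intros)+

text \<open>This is what the constant -3/2 in \<open>phase0\<close> is for: here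
  \<open>step_int (s - 1)\<close> is s - 3/2, so the phase is exactly s and both modes carry the
  same factor exp(-k s).\<close>

lemma phase_middle:
  assumes "2 \<le> s" "s \<le> 4"
  shows "phase0 s = s" "phase1 s = 1"
  using assms by (simp_all add: phase0_def phase1_def step_nonpos step_ge_1)

lemma step_int_nonneg: "0 \<le> step_int s"
proof -
  have "mono step_int"
    by (rule monoI, rule DERIV_nonneg_imp_nondecreasing)
      (use DERIV_step_int step0_bounds(1) in blast)+
  then have "step_int (min s 0) \<le> step_int s" by (auto simp: mono_def)
  then show ?thesis by (simp add: step_nonpos)
qed

lemma phase0_nonneg:
  assumes "2 \<le> s" shows "0 \<le> phase0 s"
  using assms step_int_nonneg[of "s - 4"] by (simp add: phase0_def step_ge_1)

lemma phase1_bounds: "1 \<le> phase1 s" "phase1 s \<le> 2"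
  using step0_bounds[of "s - 1"] step0_bounds[of "s - 4"] monoD[OF mono_step0, of "s - 4" "s - 1"]
  by (auto simp: phase1_def)

lemma phase2_le: "\<bar>phase2 s\<bar> \<le> 35/16"
  using step1_bounds[of "s - 1"] step1_bounds[of "s - 4"] unfolding phase2_def abs_le_iff by linarith

text \<open>The main term \<open>(phase1 s)^2 / 4\<close> lies between 1/4 and 1 and has derivative
  at most 35/16 in size; the terms divided by 4k are negligible for k at least 1000.\<close>

lemma conduct_bounds:
  assumes "1000 \<le> k"
  shows "1/5 \<le> conduct k s" "conduct k s \<le> 2" "\<bar>conduct' k s\<bar> \<le> 5"
proof -
  have "1 \<le> (phase1 s)^2" "(phase1 s)^2 \<le> 4"
    using phase1_bounds[of s] power_mono[of 1 "phase1 s" 2] power_mono[of "phase1 s" 2 2] by auto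
  moreover have "\<bar>phase2 s / (4 * k)\<bar> \<le> (35/16) / (4 * 1000)"
    unfolding abs_divide by (rule frac_le) (use assms phase2_le[of s] in auto)
  ultimately show "1/5 \<le> conduct k s" "conduct k s \<le> 2" unfolding conduct_def by linarith+
  have "\<bar>phase3 s\<bar> \<le> 54"
    using abs_step2_le[of "s - 1"] abs_step2_le[of "s - 4"] by (auto simp: phase3_def)
  then have "\<bar>phase3 s / (4 * k)\<bar> \<le> 54 / (4 * 1000)"
    unfolding abs_divide by (intro frac_le) (use assms in auto)
  moreover have "\<bar>phase1 s\<bar> * \<bar>phase2 s\<bar> \<le> 2 * (35/16)"
    by (intro mult_mono phase2_le) (use phase1_bounds[of s] in auto)
  ultimately show "\<bar>conduct' k s\<bar> \<le> 5"
    unfolding conduct'_def abs_mult[symmetric] by linarith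
qed

text \<open>The leading terms are 2k times 35/16 and 2k times 27; the remainders 27 and 210 are
  absorbed because k is at least 1000.\<close>

lemma coupling_rate_bounds:
  assumes "1000 \<le> k"
  shows "\<bar>feed k s\<bar> \<le> 5 * k" "\<bar>damp k s\<bar> \<le> 5 * k" "\<bar>feed' k s\<bar> \<le> 100 * k" "\<bar>damp' k s\<bar> \<le> 100 * k"
proof -
  have 1: "\<bar>2 * k * step1 s\<bar> \<le> 2 * k * (35/16)" for s
    unfolding abs_mult using assms step1_bounds[of s] by (intro mult_mono) auto
  have 2: "\<bar>2 * k * step2 s\<bar> \<le> 2 * k * 27" for s
    unfolding abs_mult using assms abs_step2_le[of s] by (intro mult_mono) auto
  show "\<bar>feed k s\<bar> \<le> 5 * k" "\<bar>damp k s\<bar> \<le> 5 * k"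
    using 1[of "s - 2"] 1[of "s - 3"] abs_step2_le[of "s - 2"] abs_step2_le[of "s - 3"] assms
    unfolding feed_def damp_def by linarith+
  show "\<bar>feed' k s\<bar> \<le> 100 * k" "\<bar>damp' k s\<bar> \<le> 100 * k"
    using 2[of "s - 2"] 2[of "s - 3"] abs_step3_le[of "s - 2"] abs_step3_le[of "s - 3"] assms
    unfolding feed'_def damp'_def by linarith+
qed

text \<open>Off [3, 4] the derivatives of the step vanish and the mode is free; on it the new mode
  is the bare exponential by which \<open>damp\<close> was divided. The factor 1 is the coefficient
  of A in the old direction, written out to fit \<open>wave_equation\<close>.\<close>

lemma old_equation: "old2 k s = 1 * k^2 * old0 k s - damp k s * new0 k s"
proof (cases "3 \<le> s \<and> s \<le> 4")
  case True
  then show ?thesis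
    by (simp add: old0_def old2_def damp_def new0_def phase_middle step_ge_1 algebra_simps)
next
  case False
  then have "step1 (s - 3) = 0" "step2 (s - 3) = 0"
    by (cases "s \<le> 3"; simp add: step_nonpos step_ge_1)+
  then show ?thesis by (simp add: old0_def old2_def damp_def)
qed

lemma new_equation:
  assumes "k \<noteq> 0"
  shows "new2 k s = conduct k s * (2 * k)^2 * new0 k s - feed k s * old0 k s"
proof -
  have c: "conduct k s * (2 * k)^2 = k^2 * (phase1 s)^2 - k * phase2 s"
    using assms by (simp add: conduct_def power2_eq_square field_simps)
  show ?thesis
  proof (cases "2 \<le> s \<and> s \<le> 3")
    case True
    then show ?thesis unfolding c
      by (simp add: old0_def new2_def feed_def new0_def phase_middle step_nonpos algebra_simps)
  next
    case False
    then have "step1 (s - 2) = 0" "step2 (s - 2) = 0"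
      by (cases "s \<le> 2"; simp add: step_nonpos step_ge_1)+
    then show ?thesis unfolding c by (simp add: new0_def new2_def feed_def)
  qed
qed

text \<open>The old mode grows backwards in time. The parameter \<open>S\<close> admits negative
  local times at the price exp(k S): \<open>S\<close> = 0 serves the uniform bounds on u, a positive
  \<open>S\<close> the bounds of a single profile on the whole half-line.\<close>

lemma old_bounds:
  assumes k: "1000 \<le> k" and s: "- S \<le> s"
  shows "\<bar>old0 k s\<bar> \<le> 5 * exp (k * S)" "\<bar>old1 k s\<bar> \<le> 5 * k * exp (k * S)" "\<bar>old2 k s\<bar> \<le> 5 * k^2 * exp (k * S)"
proof -
  have "k * - S \<le> k * s" using k s by (intro mult_left_mono) auto
  then have e: "exp (- k * s) \<le> exp (k * S)" by simp
  have b: "\<bar>exp (- k * s) * X\<bar> \<le> B * exp (k * S)" if "\<bar>X\<bar> \<le> B" for X B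
    using mult_mono[OF that e] that by (simp add: abs_mult mult.commute)
  define f where "f = 1 - step0 (s - 3)"
  have f: "0 \<le> f" "f \<le> 1" using step0_bounds[of "s - 3"] by (auto simp: f_def)
  have kf: "0 \<le> k * f" "k * f \<le> k" "0 \<le> k^2 * f" "k^2 * f \<le> k^2"
    using k f by (auto simp: mult_left_le)
  have kk: "1000 * k \<le> k^2" using k by (simp add: power2_eq_square)
  have 1: "0 \<le> k * step1 (s - 3)" "k * step1 (s - 3) \<le> k * (35/16)"
    using k step1_bounds[of "s - 3"] by (auto intro!: mult_left_mono)
  show "\<bar>old0 k s\<bar> \<le> 5 * exp (k * S)"
    unfolding old0_def f_def[symmetric] by (rule b) (use f in auto)
  show "\<bar>old1 k s\<bar> \<le> 5 * k * exp (k * S)"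
    unfolding old1_def f_def[symmetric]
    by (rule b, unfold abs_le_iff mult_minus_left) (use kf k step1_bounds[of "s - 3"] in linarith)
  show "\<bar>old2 k s\<bar> \<le> 5 * k^2 * exp (k * S)"
    unfolding old2_def f_def[symmetric]
  proof (rule b)
    show "\<bar>k^2 * f + 2 * k * step1 (s - 3) - step2 (s - 3)\<bar> \<le> 5 * k^2"
      unfolding mult.assoc abs_le_iff
      using kf k kk 1 abs_step2_le[of "s - 3", unfolded abs_le_iff] by linarith
  qed
qed

text \<open>The new mode is zero up to local time 2, and afterwards its phase is nonnegative; so the
  exponential never exceeds 1 where it counts, and all times are covered at once.\<close>

lemma new_bounds:
  assumes k: "1000 \<le> k"
  shows "\<bar>new0 k s\<bar> \<le> 5" "\<bar>new1 k s\<bar> \<le> 5 * k" "\<bar>new2 k s\<bar> \<le> 5 * k^2"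
proof -
  have b: "\<bar>exp (- k * phase0 s) * X\<bar> \<le> B" if "\<bar>X\<bar> \<le> B" "s \<le> 2 \<Longrightarrow> X = 0" for X B
  proof (cases "s \<le> 2")
    case True
    then show ?thesis using that by auto
  next
    case False
    then have "exp (- k * phase0 s) \<le> 1" using k phase0_nonneg[of s] by simp
    then show ?thesis using mult_mono[OF that(1), of "exp (- k * phase0 s)" 1] that(1)
      by (simp add: abs_mult mult.commute)
  qed
  define f where "f = step0 (s - 2)"
  define h where "h = phase1 s * f"
  have f: "0 \<le> f" "f \<le> 1" using step0_bounds[of "s - 2"] by (auto simp: f_def)
  have h: "0 \<le> h" "h \<le> 2" using mult_mono[of "phase1 s" 2 f 1] phase1_bounds[of s] f by (auto simp: h_def)
  have hh: "0 \<le> phase1 s * h" "phase1 s * h \<le> 4"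
    using mult_mono[of "phase1 s" 2 h 2] phase1_bounds[of s] h by auto
  have kk: "1000 * k \<le> k^2" using k by (simp add: power2_eq_square)
  have 1: "0 \<le> k * h" "k * h \<le> k * 2" using k h by auto
  have 2: "0 \<le> k^2 * (phase1 s * h)" "k^2 * (phase1 s * h) \<le> k^2 * 4"
    using mult_left_mono[OF hh(2), of "k^2"] hh by auto
  have "\<bar>phase2 s * f\<bar> \<le> 35/16 * 1"
    unfolding abs_mult by (intro mult_mono phase2_le) (use f in auto)
  then have 3: "\<bar>k * (phase2 s * f)\<bar> \<le> k * (35/16)"
    unfolding abs_mult[of k] using k by simp
  have "0 \<le> phase1 s * step1 (s - 2)" "phase1 s * step1 (s - 2) \<le> 2 * (35/16)"
    using phase1_bounds[of s] step1_bounds[of "s - 2"] mult_mono[of "phase1 s" 2 "step1 (s - 2)" "35/16"] by auto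
  then have 4: "0 \<le> k * (phase1 s * step1 (s - 2))" "k * (phase1 s * step1 (s - 2)) \<le> k * (2 * (35/16))"
    using k by (auto intro!: mult_left_mono)
  show "\<bar>new0 k s\<bar> \<le> 5"
    unfolding new0_def by (rule b) (use f in \<open>auto simp: f_def step_nonpos\<close>)
  show "\<bar>new1 k s\<bar> \<le> 5 * k"
    unfolding new1_def
  proof (rule b)
    show "\<bar>step1 (s - 2) - k * phase1 s * step0 (s - 2)\<bar> \<le> 5 * k"
      unfolding f_def[symmetric] mult.assoc h_def[symmetric] abs_le_iff
      using 1 k step1_bounds[of "s - 2"] by linarith
  qed (simp add: step_nonpos)
  show "\<bar>new2 k s\<bar> \<le> 5 * k^2"
    unfolding new2_def
  proof (rule b)
    have eq: "step2 (s - 2) - 2 * k * phase1 s * step1 (s - 2)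
       + (k^2 * (phase1 s)^2 - k * phase2 s) * step0 (s - 2)
       = step2 (s - 2) - 2 * (k * (phase1 s * step1 (s - 2))) + k^2 * (phase1 s * h) - k * (phase2 s * f)"
      by (simp add: f_def h_def algebra_simps power2_eq_square)
    show "\<bar>step2 (s - 2) - 2 * k * phase1 s * step1 (s - 2)
       + (k^2 * (phase1 s)^2 - k * phase2 s) * step0 (s - 2)\<bar> \<le> 5 * k^2"
      \<comment> \<open>The term with \<open>phase1\<close> squared is at most 4 k^2; those of order
        k and 1 fit into the remaining k^2.\<close>
      unfolding eq abs_le_iff
      using 2 3[unfolded abs_le_iff] 4 kk k abs_step2_le[of "s - 2", unfolded abs_le_iff] by linarith
  qed (simp add: step_nonpos)
qed

lemma profiles_early:
  assumes "s \<le> 1"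
  shows "old0 k s = exp (- k * s)" "new0 k s = 0" "conduct k s = 1" "feed k s = 0" "damp k s = 0"
  using assms
  by (simp_all add: old0_def new0_def conduct_def phase1_def phase2_def feed_def damp_def step_nonpos)

text \<open>Here 9/2 = 3/2 + 3: the offset of \<open>phase0\<close> plus the phase lost while its
  slope is below 2. At the end s = 6 the exponent is 15/2 times k.\<close>

lemma profiles_late:
  assumes "5 \<le> s"
  shows "old0 k s = 0" "new0 k s = exp (- k * (2 * s - 9/2))" "conduct k s = 1" "feed k s = 0" "damp k s = 0"
  using assms
  by (simp_all add: old0_def new0_def conduct_def phase0_def phase1_def phase2_def feed_def damp_def
      step_nonpos step_ge_1)

section \<open>The cascade\<close>

locale cascade =
  fixes n0 :: nat
  assumes n0: "10 \<le> n0"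
begin

definition freq :: "nat \<Rightarrow> real" where "freq j = 2 ^ (j + n0)"

text \<open>Amplitude of the surviving mode at the start of interval \<open>j\<close>, measured in
  local time; 15/2 is the phase 2s - 9/2 at s = 6.\<close>

primrec amp :: "nat \<Rightarrow> real" where
  "amp 0 = 1"
| "amp (Suc j) = amp j * exp (- (15/2) * freq j)"

text \<open>Intervals are numbered from 0: \<open>j\<close> is \<open>n - 1\<close>. In even intervals the old mode depends on \<open>x\<close> and the new one on
  \<open>y\<close>; in odd ones conversely.\<close>

definition pick :: "nat \<Rightarrow> 'a \<Rightarrow> 'a \<Rightarrow> 'a" where "pick j f g = (if even j then f else g)"

definition local :: "(real \<Rightarrow> real \<Rightarrow> real) \<Rightarrow> nat \<Rightarrow> real \<Rightarrow> real" where
  "local f j t = f (freq j) (t - 6 * real j)"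

definition scaled :: "(real \<Rightarrow> real \<Rightarrow> real) \<Rightarrow> nat \<Rightarrow> real \<Rightarrow> real" where
  "scaled f j t = amp j * local f j t"

definition px :: "nat \<Rightarrow> real" where "px j = pick j (freq j) (2 * freq j)"
definition qy :: "nat \<Rightarrow> real" where "qy j = pick j (2 * freq j) (freq j)"

definition sol :: "nat \<Rightarrow> fn3" where
  "sol j = wave (px j) (qy j) (pick j (scaled old0 j) (scaled new0 j)) (pick j (scaled new0 j) (scaled old0 j))"

definition sol_grad :: "nat \<Rightarrow> nat \<Rightarrow> fn3" where
  "sol_grad i j = wave_grad (px j) (qy j)
     (pick j (scaled old0 j) (scaled new0 j)) (pick j (scaled old1 j) (scaled new1 j))
     (pick j (scaled new0 j) (scaled old0 j)) (pick j (scaled new1 j) (scaled old1 j)) i"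

definition sol_hess :: "nat \<Rightarrow> nat \<Rightarrow> nat \<Rightarrow> fn3" where
  "sol_hess i i' j = wave_hess (px j) (qy j)
     (pick j (scaled old0 j) (scaled new0 j)) (pick j (scaled old1 j) (scaled new1 j))
     (pick j (scaled old2 j) (scaled new2 j))
     (pick j (scaled new0 j) (scaled old0 j)) (pick j (scaled new1 j) (scaled old1 j))
     (pick j (scaled new2 j) (scaled old2 j)) i i'"

definition coeff :: "nat \<Rightarrow> nat \<Rightarrow> nat \<Rightarrow> fn3" where
  "coeff i i' j = coupling (px j) (qy j) (pick j (\<lambda>t. 1) (local conduct j)) (pick j (local conduct j) (\<lambda>t. 1))
     (pick j (local feed j) (local damp j)) (pick j (local damp j) (local feed j)) i i'"

definition coeff_grad :: "nat \<Rightarrow> nat \<Rightarrow> nat \<Rightarrow> nat \<Rightarrow> fn3" where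
  "coeff_grad i i' l j = coupling_grad (px j) (qy j) (pick j (\<lambda>t. 0) (local conduct' j)) (pick j (local conduct' j) (\<lambda>t. 0))
     (pick j (local feed j) (local damp j)) (pick j (local damp j) (local feed j))
     (pick j (local feed' j) (local damp' j)) (pick j (local damp' j) (local feed' j)) i i' l"

definition sol_flux :: "nat \<Rightarrow> nat \<Rightarrow> fn3" where
  "sol_flux i j = flux (px j) (qy j) (pick j (\<lambda>t. 1) (local conduct j)) (pick j (local conduct j) (\<lambda>t. 1))
     (pick j (local feed j) (local damp j)) (pick j (local damp j) (local feed j))
     (pick j (scaled old0 j) (scaled new0 j)) (pick j (scaled new0 j) (scaled old0 j)) i"

definition sol_flux_deriv :: "nat \<Rightarrow> nat \<Rightarrow> fn3" where
  "sol_flux_deriv i j = flux_deriv (px j) (qy j) (pick j (\<lambda>t. 1) (local conduct j)) (pick j (local conduct j) (\<lambda>t. 1))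
     (pick j (local feed j) (local damp j)) (pick j (local damp j) (local feed j))
     (pick j (scaled old0 j) (scaled new0 j)) (pick j (scaled new0 j) (scaled old0 j)) i"

section \<open>Amplitudes against frequencies, and the equation on each interval\<close>

lemma freq_Suc: "freq (Suc j) = 2 * freq j" by (simp add: freq_def)

lemma freq_ge: "1000 \<le> freq j" "2 ^ j \<le> freq j"
proof -
  have "(2::real) ^ 10 \<le> 2 ^ (j + n0)" using n0 by (intro power_increasing) auto
  then show "1000 \<le> freq j" by (simp add: freq_def)
  show "2 ^ j \<le> freq j" by (simp add: freq_def power_increasing)
qed

lemma amp_pos: "0 < amp j" by (induction j) auto

text \<open>Doubling makes the increment of the frequency equal to \<open>freq j\<close>, which is
  less than the loss \<open>15/2 * freq j\<close> in the exponent; the increments telescope.\<close>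

lemma amp_le: "amp j \<le> exp (freq 0 - freq j)"
proof (induction j)
  case (Suc j)
  have "amp (Suc j) \<le> exp (freq 0 - freq j) * exp (- (15/2) * freq j)"
    using Suc by simp
  also have "\<dots> = exp (freq 0 - freq j - 15/2 * freq j)" by (simp add: exp_add[symmetric])
  also have "\<dots> \<le> exp (freq 0 - freq (Suc j))" using freq_ge(1)[of j] by (simp add: freq_Suc)
  finally show ?case .
qed simp

text \<open>Second derivatives of u cost two powers of the frequency; the amplitude pays for them,
  since x^2/2 is at most exp(x).\<close>

lemma amp_freq_le: "amp j * (freq j)^2 \<le> 2 * exp (freq 0)"
proof -
  have "(freq j)^2 \<le> 2 * exp (freq j)"
    using exp_lower_Taylor_quadratic[of "freq j"] freq_ge(1)[of j] by auto
  then have "amp j * (freq j)^2 \<le> exp (freq 0 - freq j) * (2 * exp (freq j))"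
    by (intro mult_mono amp_le) auto
  also have "\<dots> = 2 * exp (freq 0)" by (simp add: exp_diff)
  finally show ?thesis .
qed

lemma pq_bounds: "freq j \<le> px j" "px j \<le> 2 * freq j" "freq j \<le> qy j" "qy j \<le> 2 * freq j" "0 < px j" "0 < qy j"
  using freq_ge(1)[of j] by (auto simp: px_def qy_def pick_def)

lemma DERIV_local:
  assumes "\<And>k s. (f k has_real_derivative g k s) (at s)"
  shows "(local f j has_real_derivative local g j t) (at t)"
    "(scaled f j has_real_derivative scaled g j t) (at t)"
proof -
  have *: "((\<lambda>t. t - 6 * real j) has_real_derivative 1) (at t)" by (auto intro!: derivative_eq_intros)
  show 1: "(local f j has_real_derivative local g j t) (at t)"
    unfolding local_def[abs_def] using DERIV_chain2[OF assms *] by simp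
  show "(scaled f j has_real_derivative scaled g j t) (at t)"
    unfolding scaled_def[abs_def] by (rule DERIV_cmult[OF 1])
qed

lemma continuous_local:
  assumes "\<And>k. continuous_on UNIV (f k)"
  shows "continuous_on UNIV (local f j)" "continuous_on UNIV (scaled f j)"
proof -
  show 1: "continuous_on UNIV (local f j)"
    unfolding local_def[abs_def] by (rule continuous_on_compose2[OF assms]) (auto intro!: continuous_intros)
  show "continuous_on UNIV (scaled f j)"
    unfolding scaled_def[abs_def] by (intro continuous_intros 1)
qed

lemma continuous_on_local_DERIV:
  assumes "\<And>k s. (f k has_real_derivative g k s) (at s)"
  shows "continuous_on UNIV (local f j)" "continuous_on UNIV (scaled f j)"
  by (rule continuous_local; meson assms DERIV_isCont continuous_at_imp_continuous_on)+

lemmas continuous_modes =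
  continuous_on_local_DERIV[OF DERIV_modes(1)] continuous_on_local_DERIV[OF DERIV_modes(2)]
  continuous_on_local_DERIV[OF DERIV_modes(3)] continuous_on_local_DERIV[OF DERIV_modes(4)]
  continuous_on_local_DERIV[OF DERIV_coefficients(1)] continuous_on_local_DERIV[OF DERIV_coefficients(2)]
  continuous_on_local_DERIV[OF DERIV_coefficients(3)]
  continuous_local[OF continuous_on_profiles(1)] continuous_local[OF continuous_on_profiles(2)]
  continuous_local[OF continuous_on_profiles(3)] continuous_local[OF continuous_on_profiles(4)]
  continuous_local[OF continuous_on_profiles(5)]

lemma full_pd_family:
  "full_pd i (sol j) (sol_grad i j)" "full_pd i' (sol_grad i j) (sol_hess i i' j)" "full_pd l (coeff i i' j) (coeff_grad i i' l j)"
  unfolding sol_def sol_grad_def sol_hess_def coeff_def coeff_grad_def pick_def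
  by (cases "even j"; simp only: if_True if_False;
      intro full_pd_wave full_pd_wave_grad full_pd_coupling DERIV_local DERIV_modes DERIV_coefficients
        DERIV_const)+

lemma full_pd_sol_flux: "i < 2 \<Longrightarrow> full_pd i (sol_flux i j) (sol_flux_deriv i j)"
  unfolding sol_flux_def sol_flux_deriv_def using pq_bounds[of j] by (intro full_pd_flux) auto

lemma full_cont_family:
  "full_cont (sol j)" "full_cont (sol_grad i j)" "full_cont (sol_hess i i' j)" "full_cont (coeff i i' j)" "full_cont (coeff_grad i i' l j)"
  unfolding sol_def sol_grad_def sol_hess_def coeff_def coeff_grad_def pick_def
  by (cases "even j"; simp only: if_True if_False;
      intro full_cont_wave full_cont_wave_grad full_cont_wave_hess full_cont_coupling full_cont_coupling_grad
        continuous_modes continuous_on_const)+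

lemma equation: "sol_hess 2 2 j x y t + (\<Sum>i<2. sol_flux_deriv i j x y t) = 0"
proof -
  define s where "s = t - 6 * real j"
  have k: "freq j \<noteq> 0" using freq_ge(1)[of j] by auto
  note eqs = old_equation[of "freq j" s] new_equation[OF k, of s]
  have loc: "scaled f j t = amp j * f (freq j) s" "local f j t = f (freq j) s" for f
    by (simp_all add: scaled_def local_def s_def)
  have "sol_hess 2 2 j = wave (px j) (qy j) (pick j (scaled old2 j) (scaled new2 j)) (pick j (scaled new2 j) (scaled old2 j))"
    by (simp add: sol_hess_def wave_hess_def wave_grad_def)
  then show ?thesis unfolding sol_flux_deriv_def
    by (simp only:, intro wave_equation)
      (simp_all add: pick_def px_def qy_def loc eqs algebra_simps)
qed

text \<open>The exponentials are written in absolute time, so that the new mode late in interval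
  \<open>j\<close> and the old mode early in interval \<open>Suc j\<close> are literally the same
  expression.\<close>

lemma local_values:
  assumes "t \<le> 6 * real j + 1"
  shows "scaled old0 j t = amp j * exp (freq j * (6 * real j)) * exp (- freq j * t)" "scaled new0 j t = 0"
    "local conduct j t = 1" "local feed j t = 0" "local damp j t = 0"
  using assms profiles_early[of "t - 6 * real j" "freq j"]
  by (auto simp: scaled_def local_def exp_add[symmetric] algebra_simps)

lemma local_values_late:
  assumes "6 * real j + 5 \<le> t"
  shows "scaled old0 j t = 0"
    "scaled new0 j t = amp (Suc j) * exp (freq (Suc j) * (6 * real (Suc j))) * exp (- freq (Suc j) * t)"
    "local conduct j t = 1" "local feed j t = 0" "local damp j t = 0"
  using assms profiles_late[of "t - 6 * real j" "freq j"]
  by (auto simp: scaled_def local_def freq_Suc exp_add[symmetric] algebra_simps)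

text \<open>Every index other than 0 stands for y in \<open>coupling\<close>; comparing
  \<open>i = 0\<close> with \<open>i' = 0\<close> makes the claim correct for all natural
  indices.\<close>

lemma coupling_identity:
  assumes "t \<le> 6 * real j + 1 \<or> 6 * real j + 5 \<le> t"
  shows "coeff i i' j x y t = (if i = 0 \<longleftrightarrow> i' = 0 then 1 else 0)"
proof -
  have "local conduct j t = 1" "local feed j t = 0" "local damp j t = 0"
    using assms local_values[of t j] local_values_late[of j t] by auto
  then show ?thesis by (auto simp: coeff_def coupling_def entry_def pick_def)
qed

text \<open>Around the joint only one mode is alive, the new one before and the old one after. The
  change of parity swaps the roles in \<open>pick\<close>, so it keeps its variable and its
  frequency.\<close>

lemma compatible_sol: "compatible sol"
  unfolding compatible_def
proof (intro allI impI)
  fix n x y t assume t: "\<bar>t - 6 * real (Suc n)\<bar> < 1"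
  then have "6 * real n + 5 \<le> t" "t \<le> 6 * real (Suc n) + 1" by auto
  note late = local_values_late[OF this(1)] and early = local_values[OF this(2)]
  show "sol n x y t = sol (Suc n) x y t"
    by (simp add: sol_def wave_def pick_def px_def qy_def late(1,2) early(1,2) freq_Suc del: amp.simps)
qed

lemma compatible_coeff: "compatible (coeff i i')"
  unfolding compatible_def
proof (intro allI impI)
  fix n x y t assume t: "\<bar>t - 6 * real (Suc n)\<bar> < 1"
  then show "coeff i i' n x y t = coeff i i' (Suc n) x y t"
    by (subst (1 2) coupling_identity) auto
qed

lemma sol_flux_eq: "sol_flux i j x y t = (\<Sum>i'<2. coeff i i' j x y t * sol_grad i' j x y t)"
  by (simp add: sol_flux_def flux_def coeff_def sol_grad_def sum_lessThan_2 wave_grad_def)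

lemma compatible_derivatives:
  "compatible (sol_grad i)" "compatible (sol_hess i i')" "compatible (coeff_grad i i' l)" "compatible (sol_flux i)"
proof -
  show sol_grad: "compatible (sol_grad i)" for i by (rule compatible_pd[OF compatible_sol full_pd_family(1)])
  show "compatible (sol_hess i i')" by (rule compatible_pd[OF sol_grad full_pd_family(2)])
  show "compatible (coeff_grad i i' l)" by (rule compatible_pd[OF compatible_coeff full_pd_family(3)])
  show "compatible (sol_flux i)"
    using sol_grad compatible_coeff unfolding compatible_def sol_flux_eq by simp
qed

lemma solves: "solves_eq (\<lambda>i i'. glue (coeff i i')) (glue sol)"
  unfolding solves_eq_def
proof (rule exI[of _ "\<lambda>i. glue (sol_grad i)"], rule exI[of _ "\<lambda>i i'. glue (sol_hess i i')"],
    rule exI[of _ "\<lambda>i. glue (sol_flux_deriv i)"], intro conjI allI impI)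
  show "is_pd i (glue sol) (glue (sol_grad i))" for i
    by (rule is_pd_glue[OF compatible_sol full_pd_family(1)])
  show "is_pd i' (glue (sol_grad i)) (glue (sol_hess i i'))" for i i'
    by (rule is_pd_glue[OF compatible_derivatives(1) full_pd_family(2)])
  show "is_pd i (\<lambda>x y t. \<Sum>j<2. glue (coeff i j) x y t * glue (sol_grad j) x y t) (glue (sol_flux_deriv i))" if "i < 2" for i
    using is_pd_glue[OF compatible_derivatives(4)[of i] full_pd_sol_flux[OF that]]
    \<comment> \<open>Gluing merely selects an index, hence commutes with sums and products, and the
      flux of the glued data is the glued flux.\<close>
    by (simp add: glue_def[abs_def] sol_flux_eq)
  show "glue (sol_hess 2 2) x y t + (\<Sum>i<2. glue (sol_flux_deriv i) x y t) = 0" for x y t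
    unfolding glue_def by (rule equation)
qed

lemma regular: "regclass 80 60 (\<lambda>i i'. glue (coeff i i'))"
  unfolding regclass_def
proof (intro conjI allI impI)
  fix x y t :: real and \<xi> :: "nat \<Rightarrow> real"
  define j where "j = nat \<lfloor>t / 6\<rfloor>"
  have r: "\<bar>pick j (local feed j) (local damp j) t\<bar> \<le> 5 * freq j" "\<bar>pick j (local damp j) (local feed j) t\<bar> \<le> 5 * freq j"
    using coupling_rate_bounds(1,2)[OF freq_ge(1)] by (auto simp: pick_def local_def)
  have d: "1/5 \<le> pick j (\<lambda>t. 1) (local conduct j) t" "pick j (\<lambda>t. 1) (local conduct j) t \<le> 2"
    "1/5 \<le> pick j (local conduct j) (\<lambda>t. 1) t" "pick j (local conduct j) (\<lambda>t. 1) t \<le> 2"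
    using conduct_bounds(1,2)[OF freq_ge(1)] by (auto simp: pick_def local_def)
  define a where "a = (\<lambda>i i'. coeff i i' j x y t)"
  have a: "\<bar>a i i' - (if i = 0 \<and> i' = 0 then pick j (\<lambda>t. 1) (local conduct j) t else if i = 0 \<or> i' = 0 then 0
      else pick j (local conduct j) (\<lambda>t. 1) t)\<bar> \<le> 1/100" for i i'
    unfolding a_def coeff_def by (rule coupling_near_diagonal[where k = "freq j"]; rule freq_ge(1) pq_bounds(1,3) r)
  \<comment> \<open>The diagonal perturbation is at most 1/100. Of the off-diagonal entries the
    quadratic form sees only the sum, whence the bound 1/50 although A is not symmetric.\<close>
  have a00: "1/6 \<le> a 0 0" "a 0 0 \<le> 3" and a11: "1/6 \<le> a (Suc 0) (Suc 0)" "a (Suc 0) (Suc 0) \<le> 3"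
    and a01: "\<bar>a 0 (Suc 0) + a (Suc 0) 0\<bar> \<le> 1/50"
    using a[of 0 0] a[of 0 "Suc 0"] a[of "Suc 0" 0] a[of "Suc 0" "Suc 0"] d unfolding abs_le_iff by auto
  have "2 * (\<xi> 0 * \<xi> 1) \<le> (\<xi> 0)^2 + (\<xi> 1)^2" "- (2 * (\<xi> 0 * \<xi> 1)) \<le> (\<xi> 0)^2 + (\<xi> 1)^2"
    using zero_le_power2[of "\<xi> 0 - \<xi> 1"] zero_le_power2[of "\<xi> 0 + \<xi> 1"]
    by (simp_all add: power2_sum power2_diff)
  then have "\<bar>\<xi> 0 * \<xi> 1\<bar> \<le> (\<xi> 0)^2 + (\<xi> 1)^2"
    unfolding abs_le_iff using sum_power2_ge_zero[of "\<xi> 0" "\<xi> 1"] by linarith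
  then have cross: "\<bar>(a 0 1 + a 1 0) * (\<xi> 0 * \<xi> 1)\<bar> \<le> 1/50 * ((\<xi> 0)^2 + (\<xi> 1)^2)"
    unfolding abs_mult[of "a 0 1 + a 1 0"] using a01 by (intro mult_mono) auto
  have diag: "1/6 * (\<xi> 0)^2 \<le> a 0 0 * (\<xi> 0)^2" "a 0 0 * (\<xi> 0)^2 \<le> 3 * (\<xi> 0)^2"
    "1/6 * (\<xi> 1)^2 \<le> a 1 1 * (\<xi> 1)^2" "a 1 1 * (\<xi> 1)^2 \<le> 3 * (\<xi> 1)^2"
    using mult_right_mono[OF a00(1) zero_le_power2] mult_right_mono[OF a00(2) zero_le_power2]
      mult_right_mono[OF a11(1) zero_le_power2] mult_right_mono[OF a11(2) zero_le_power2]
    by (simp_all only: One_nat_def)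
  have form: "(\<Sum>i<2. \<Sum>j<2. \<xi> i * glue (coeff i j) x y t * \<xi> j)
    = a 0 0 * (\<xi> 0)^2 + (a 0 1 + a 1 0) * (\<xi> 0 * \<xi> 1) + a 1 1 * (\<xi> 1)^2"
    by (simp add: sum_lessThan_2 glue_def j_def a_def algebra_simps power2_eq_square)
  have pos: "0 \<le> (\<xi> 0)^2" "0 \<le> (\<xi> 1)^2" by simp_all
  \<comment> \<open>In terms of the squares everything is linear: 1/6 - 1/50 exceeds 1/80, and 3 +
    1/50 is below 80.\<close>
  have combine: "inverse 80 * (X + Y) \<le> A + c + B" "A + c + B \<le> 80 * (X + Y)"
    if "c \<le> 1/50 * (X + Y)" "- c \<le> 1/50 * (X + Y)" "1/6 * X \<le> A" "A \<le> 3 * X"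
      "1/6 * Y \<le> B" "B \<le> 3 * Y" "0 \<le> X" "0 \<le> Y" for X Y A B c :: real
    using that by simp_all
  show "inverse 80 * (\<Sum>i<2. (\<xi> i)^2) \<le> (\<Sum>i<2. \<Sum>j<2. \<xi> i * glue (coeff i j) x y t * \<xi> j)"
    "(\<Sum>i<2. \<Sum>j<2. \<xi> i * glue (coeff i j) x y t * \<xi> j) \<le> 80 * (\<Sum>i<2. (\<xi> i)^2)"
    unfolding form unfolding sum_lessThan_2 One_nat_def[symmetric]
    by (rule combine[OF abs_le_D1[OF cross] abs_le_D2[OF cross] diag pos])+
next
  fix i i' :: nat
  show "cont3 (glue (coeff i i'))" by (rule cont3_glue[OF compatible_coeff full_cont_family(4)])
  show "\<exists>D. \<forall>k<3. is_pd k (glue (coeff i i')) (D k) \<and> cont3 (D k) \<and> (\<forall>x y t. 0 \<le> t \<longrightarrow> \<bar>D k x y t\<bar> \<le> 60)"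
  proof (intro exI[of _ "\<lambda>l. glue (coeff_grad i i' l)"] allI impI conjI)
    fix l :: nat
    show "is_pd l (glue (coeff i i')) (glue (coeff_grad i i' l))"
      by (rule is_pd_glue[OF compatible_coeff full_pd_family(3)])
    show "cont3 (glue (coeff_grad i i' l))"
      by (rule cont3_glue[OF compatible_derivatives(3) full_cont_family(5)])
    show "\<bar>glue (coeff_grad i i' l) x y t\<bar> \<le> 60" for x y t
      unfolding glue_def coeff_grad_def
      by (rule coupling_grad_le[OF freq_ge(1) pq_bounds(1-4)])
        (use coupling_rate_bounds[OF freq_ge(1)] conduct_bounds(3)[OF freq_ge(1)] in \<open>simp_all add: pick_def local_def\<close>)
  qed
qed

section \<open>Uniform bounds and decay of the glued solution\<close>

lemma scaled_bounds:
  assumes "6 * real j \<le> t"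
  shows "\<bar>scaled old0 j t\<bar> \<le> 5 * amp j" "\<bar>scaled old1 j t\<bar> \<le> 5 * amp j * freq j" "\<bar>scaled old2 j t\<bar> \<le> 5 * amp j * (freq j)^2"
    "\<bar>scaled new0 j t\<bar> \<le> 5 * amp j" "\<bar>scaled new1 j t\<bar> \<le> 5 * amp j * freq j" "\<bar>scaled new2 j t\<bar> \<le> 5 * amp j * (freq j)^2"
proof -
  have sc: "\<bar>scaled f j t\<bar> \<le> amp j * B" if "\<bar>f (freq j) (t - 6 * real j)\<bar> \<le> B" for f B
    using mult_left_mono[OF that, of "amp j"] amp_pos[of j] by (simp add: scaled_def local_def abs_mult)
  have "- 0 \<le> t - 6 * real j" using assms by simp
  note old = old_bounds[OF freq_ge(1)[of j] this]
  show "\<bar>scaled old0 j t\<bar> \<le> 5 * amp j" "\<bar>scaled old1 j t\<bar> \<le> 5 * amp j * freq j" "\<bar>scaled old2 j t\<bar> \<le> 5 * amp j * (freq j)^2"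
    using sc[of old0, OF old(1)] sc[of old1, OF old(2)] sc[of old2, OF old(3)] by simp_all
  show "\<bar>scaled new0 j t\<bar> \<le> 5 * amp j" "\<bar>scaled new1 j t\<bar> \<le> 5 * amp j * freq j" "\<bar>scaled new2 j t\<bar> \<le> 5 * amp j * (freq j)^2"
    using sc[of new0, OF new_bounds(1)[OF freq_ge(1)]] sc[of new1, OF new_bounds(2)[OF freq_ge(1)]]
      sc[of new2, OF new_bounds(3)[OF freq_ge(1)]] by simp_all
qed

lemma sol_le:
  assumes "6 * real j \<le> t"
  shows "\<bar>sol j x y t\<bar> \<le> 10 * amp j"
proof -
  have "\<bar>P * cos a + Q * cos b\<bar> \<le> 10 * amp j" if "\<bar>P\<bar> \<le> 5 * amp j" "\<bar>Q\<bar> \<le> 5 * amp j" for P Q a b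
  proof -
    have "\<bar>P * cos a\<bar> \<le> 5 * amp j * 1" "\<bar>Q * cos b\<bar> \<le> 5 * amp j * 1"
      unfolding abs_mult using that amp_pos[of j] by (intro mult_mono; simp)+
    then show ?thesis by linarith
  qed
  then show ?thesis using scaled_bounds[OF assms] by (simp add: sol_def wave_def pick_def)
qed

text \<open>Frequencies are at most 2k, so two spatial derivatives cost 4 k^2, and two modes give 8
  m k^2 with m = 5 \<open>amp j\<close>. By \<open>amp_freq_le\<close> this is at most 80
  exp(\<open>freq 0\<close>), independently of \<open>j\<close>.\<close>

lemma family_le:
  assumes t: "6 * real j \<le> t" and i: "i < 3" "i' < 3"
  shows "\<bar>sol j x y t\<bar> \<le> 80 * exp (freq 0)" "\<bar>sol_grad i j x y t\<bar> \<le> 80 * exp (freq 0)" "\<bar>sol_hess i i' j x y t\<bar> \<le> 80 * exp (freq 0)"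
proof -
  define k where "k = freq j"
  define m where "m = 5 * amp j"
  have k: "1 \<le> k" "0 < m" using freq_ge(1)[of j] amp_pos[of j] by (auto simp: k_def m_def)
  have B: "8 * (m * k^2) \<le> 80 * exp (freq 0)" using amp_freq_le[of j] by (simp add: k_def m_def)
  have kk: "k \<le> k^2" using k by (simp add: power2_eq_square)
  have mk: "m \<le> m * k" "m * k \<le> m * k^2" using k kk by simp_all
  define P0 P1 P2 Q0 Q1 Q2 where PQ_def:
    "P0 = pick j (scaled old0 j) (scaled new0 j)" "P1 = pick j (scaled old1 j) (scaled new1 j)"
    "P2 = pick j (scaled old2 j) (scaled new2 j)" "Q0 = pick j (scaled new0 j) (scaled old0 j)"
    "Q1 = pick j (scaled new1 j) (scaled old1 j)" "Q2 = pick j (scaled new2 j) (scaled old2 j)"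
  have PQ: "sol j = wave (px j) (qy j) P0 Q0" "sol_grad i j = wave_grad (px j) (qy j) P0 P1 Q0 Q1 i"
    "sol_hess i i' j = wave_hess (px j) (qy j) P0 P1 P2 Q0 Q1 Q2 i i'"
    by (simp_all add: sol_def sol_grad_def sol_hess_def PQ_def)
  have b: "\<bar>P0 t\<bar> \<le> m" "\<bar>P1 t\<bar> \<le> m * k" "\<bar>P2 t\<bar> \<le> m * k^2"
      "\<bar>Q0 t\<bar> \<le> m" "\<bar>Q1 t\<bar> \<le> m * k" "\<bar>Q2 t\<bar> \<le> m * k^2"
    using scaled_bounds[OF t] by (auto simp: PQ_def pick_def m_def k_def)
  have pq: "\<bar>px j\<bar> \<le> 2 * k" "\<bar>qy j\<bar> \<le> 2 * k"
    using pq_bounds[of j] by (auto simp: k_def)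
  have wv: "\<bar>wave p q P Q x y t\<bar> \<le> \<bar>P t\<bar> + \<bar>Q t\<bar>" for p q P Q
  proof -
    have "\<bar>P t * cos (p * x)\<bar> \<le> \<bar>P t\<bar> * 1" "\<bar>Q t * cos (q * y)\<bar> \<le> \<bar>Q t\<bar> * 1"
      unfolding abs_mult by (intro mult_left_mono; simp)+
    then show ?thesis unfolding wave_def by linarith
  qed
  have sn: "\<bar>p * P * sin z\<bar> \<le> 2 * k * R" if "\<bar>p\<bar> \<le> 2 * k" "\<bar>P\<bar> \<le> R" for p P R z :: real
  proof -
    have "\<bar>p\<bar> * \<bar>P\<bar> * \<bar>sin z\<bar> \<le> (2 * k) * R * 1"
      using that k by (intro mult_mono) (auto intro: order_trans[OF abs_ge_zero])
    then show ?thesis by (simp add: abs_mult)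
  qed
  have sq: "\<bar>p^2 * P\<bar> \<le> 4 * (m * k^2)" if "\<bar>p\<bar> \<le> 2 * k" "\<bar>P\<bar> \<le> m" for p P :: real
  proof -
    have "\<bar>p\<bar> * \<bar>p\<bar> * \<bar>P\<bar> \<le> (2 * k) * (2 * k) * m"
      using that k by (intro mult_mono) auto
    then show ?thesis by (simp add: abs_mult power2_eq_square mult_ac)
  qed
  have x: "\<bar>wave_x (px j) P x y t\<bar> \<le> 8 * (m * k^2)" "\<bar>wave_y (qy j) P x y t\<bar> \<le> 8 * (m * k^2)"
    if "\<bar>P t\<bar> \<le> m * k" for P
    using sn[OF pq(1) that, of "px j * x"] sn[OF pq(2) that, of "qy j * y"] mk k
    by (simp_all add: wave_x_def wave_y_def power2_eq_square mult_ac)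
  have w: "\<bar>wave p q P Q x y t\<bar> \<le> 8 * (m * k^2)" if "\<bar>P t\<bar> \<le> 4 * (m * k^2)" "\<bar>Q t\<bar> \<le> 4 * (m * k^2)" for p q P Q
    using wv[of p q P Q] that by linarith
  have up: "a \<le> m * k" "a \<le> 4 * (m * k^2)" if "a \<le> m" for a using that mk k by linarith+
  have up': "a \<le> 4 * (m * k^2)" if "a \<le> m * k" for a using that mk k by linarith
  have up'': "a \<le> 4 * (m * k^2)" if "a \<le> m * k^2" for a using that mk k by linarith
  note b' = up(1)[OF b(1)] up(1)[OF b(4)]
  note b4 = up(2)[OF b(1)] up'[OF b(2)] up''[OF b(3)] up(2)[OF b(4)] up'[OF b(5)] up''[OF b(6)]
  have if_le: "\<bar>(if c then F else G) x y t\<bar> \<le> B"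
    if "\<bar>F x y t\<bar> \<le> B" "\<bar>G x y t\<bar> \<le> B" for c and F G :: fn3 and x y t B
    using that by simp
  have g: "\<bar>wave_grad (px j) (qy j) P P' Q Q' i x y t\<bar> \<le> 8 * (m * k^2)"
    if "\<bar>P t\<bar> \<le> m * k" "\<bar>Q t\<bar> \<le> m * k" "\<bar>P' t\<bar> \<le> 4 * (m * k^2)" "\<bar>Q' t\<bar> \<le> 4 * (m * k^2)" for P P' Q Q' i
    unfolding wave_grad_def by (intro if_le x w that)
  have p2: "\<bar>- ((px j)^2) * P0 t\<bar> \<le> 4 * (m * k^2)" "\<bar>- ((qy j)^2) * Q0 t\<bar> \<le> 4 * (m * k^2)"
    using sq[OF pq(1) b(1)] sq[OF pq(2) b(4)] by simp_all
  have h: "\<bar>wave_hess (px j) (qy j) P0 P1 P2 Q0 Q1 Q2 i i' x y t\<bar> \<le> 8 * (m * k^2)"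
  proof -
    have "0 \<le> 8 * (m * k^2)" using k by simp
    moreover have "\<bar>wave (px j) (qy j) (\<lambda>t. - ((px j)^2) * P0 t) (\<lambda>t. 0) x y t\<bar> \<le> 8 * (m * k^2)"
      "\<bar>wave (px j) (qy j) (\<lambda>t. 0) (\<lambda>t. - ((qy j)^2) * Q0 t) x y t\<bar> \<le> 8 * (m * k^2)"
      by (rule w; use p2 calculation in simp)+
    moreover have "\<bar>(\<lambda>x y t. 0) x y t\<bar> \<le> 8 * (m * k^2)" using calculation by simp
    ultimately show ?thesis
      unfolding wave_hess_def by (intro if_le x g b b4)
  qed
  show "\<bar>sol j x y t\<bar> \<le> 80 * exp (freq 0)" unfolding PQ using w[of P0 Q0, OF b4(1,4)] B by (rule order_trans)
  show "\<bar>sol_grad i j x y t\<bar> \<le> 80 * exp (freq 0)" unfolding PQ using g[of P0 Q0 P1 Q1, OF b' b4(2,5)] B by (rule order_trans)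
  show "\<bar>sol_hess i i' j x y t\<bar> \<le> 80 * exp (freq 0)" unfolding PQ using h B by (rule order_trans)
qed

lemma uniformly_C2: "unifC2 (glue sol)"
proof -
  have "bdd3 (glue sol)" "bdd3 (glue (sol_grad i))" "bdd3 (glue (sol_hess i i'))" if i: "i < 3" "i' < 3" for i i'
  proof -
    have "\<bar>glue sol x y t\<bar> \<le> 80 * exp (freq 0)" "\<bar>glue (sol_grad i) x y t\<bar> \<le> 80 * exp (freq 0)"
      "\<bar>glue (sol_hess i i') x y t\<bar> \<le> 80 * exp (freq 0)" if "0 \<le> t" for x y t
      by (rule glue_abs_le[OF that], rule family_le[OF _ i], assumption)+
    then show "bdd3 (glue sol)" "bdd3 (glue (sol_grad i))" "bdd3 (glue (sol_hess i i'))"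
      unfolding bdd3_def by blast+
  qed
  from this(1)[of 0 0] this(2)[of _ 0] this(3)
  show ?thesis
    unfolding unifC2_def
    using cont3_glue[OF compatible_sol full_cont_family(1)]
      is_pd_glue[OF compatible_sol full_pd_family(1)]
      cont3_glue[OF compatible_derivatives(1) full_cont_family(2)]
      is_pd_glue[OF compatible_derivatives(1) full_pd_family(2)]
      cont3_glue[OF compatible_derivatives(2) full_cont_family(3)]
    by (intro conjI exI[of _ "\<lambda>i. glue (sol_grad i)"] exI[of _ "\<lambda>i i'. glue (sol_hess i i')"]) auto
qed

text \<open>The profiles have to be bounded on the whole half-line, also before their own interval;
  the bound may depend on \<open>j\<close>.\<close>

lemma unifC2_1_scaled: "unifC2_1 (scaled old0 j)" "unifC2_1 (scaled new0 j)"
proof -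
  have C2: "unifC2_1 (scaled f j)"
    if d: "\<And>k s. (f k has_real_derivative f1 k s) (at s)" "\<And>k s. (f1 k has_real_derivative f2 k s) (at s)"
      and c: "\<And>k. continuous_on UNIV (f2 k)"
      and b: "\<And>t. 0 \<le> t \<Longrightarrow> \<bar>f (freq j) (t - 6 * real j)\<bar> \<le> B \<and> \<bar>f1 (freq j) (t - 6 * real j)\<bar> \<le> B \<and> \<bar>f2 (freq j) (t - 6 * real j)\<bar> \<le> B"
    for f f1 f2 B
    unfolding unifC2_1_def
  proof (rule exI[of _ "scaled f1 j"], rule exI[of _ "scaled f2 j"], intro conjI allI impI exI[of _ "amp j * B"])
    fix t :: real
    show "(scaled f j has_real_derivative scaled f1 j t) (at t within {0..})"
      "(scaled f1 j has_real_derivative scaled f2 j t) (at t within {0..})"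
      using DERIV_local(2)[where f = f, OF d(1)] DERIV_local(2)[where f = f1, OF d(2)] by (auto intro: has_field_derivative_at_within)
    assume "0 \<le> t"
    from b[OF this] show "\<bar>scaled f j t\<bar> \<le> amp j * B" "\<bar>scaled f1 j t\<bar> \<le> amp j * B" "\<bar>scaled f2 j t\<bar> \<le> amp j * B"
      using amp_pos[of j] by (auto simp: scaled_def local_def abs_mult)
  next
    show "continuous_on {0..} (scaled f j)" "continuous_on {0..} (scaled f1 j)" "continuous_on {0..} (scaled f2 j)"
      using continuous_on_local_DERIV(2)[where f = f, OF d(1)] continuous_on_local_DERIV(2)[where f = f1, OF d(2)]
        continuous_local(2)[where f = f2, OF c]
      by (auto intro: continuous_on_subset)
  qed
  have kk: "freq j \<le> (freq j)^2" "1 \<le> (freq j)^2"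
    using freq_ge(1)[of j] one_le_power[of "freq j" 2] by (simp_all add: power2_eq_square)
  have le: "5 * e \<le> 5 * (freq j)^2 * e" "5 * freq j * e \<le> 5 * (freq j)^2 * e" if "0 \<le> e" for e
    using mult_right_mono[OF kk(1) that] mult_right_mono[OF kk(2) that] by simp_all
  show "unifC2_1 (scaled old0 j)"
  proof (rule C2[OF DERIV_modes(1,2) continuous_on_profiles(1)], intro conjI)
    fix t :: real assume "0 \<le> t"
    \<comment> \<open>Local time begins at -6j, so \<open>S\<close> = 6j and the bound contains
      exp(6 j \<open>freq j\<close>).\<close>
    then have "- (6 * real j) \<le> t - 6 * real j" by simp
    note b = old_bounds[OF freq_ge(1)[of j] this]
    show "\<bar>old0 (freq j) (t - 6 * real j)\<bar> \<le> 5 * (freq j)^2 * exp (freq j * (6 * real j))"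
      by (rule order_trans[OF b(1) le(1)]) simp
    show "\<bar>old1 (freq j) (t - 6 * real j)\<bar> \<le> 5 * (freq j)^2 * exp (freq j * (6 * real j))"
      by (rule order_trans[OF b(2) le(2)]) simp
    show "\<bar>old2 (freq j) (t - 6 * real j)\<bar> \<le> 5 * (freq j)^2 * exp (freq j * (6 * real j))"
      by (rule b(3))
  qed
  show "unifC2_1 (scaled new0 j)"
  proof (rule C2[OF DERIV_modes(3,4) continuous_on_profiles(2)], intro conjI)
    fix t :: real
    note b = new_bounds[OF freq_ge(1)[of j], of "t - 6 * real j"]
    show "\<bar>new0 (freq j) (t - 6 * real j)\<bar> \<le> 5 * (freq j)^2"
      by (rule order_trans[OF b(1)]) (use kk in simp)
    show "\<bar>new1 (freq j) (t - 6 * real j)\<bar> \<le> 5 * (freq j)^2"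
      by (rule order_trans[OF b(2)]) (use kk in simp)
    show "\<bar>new2 (freq j) (t - 6 * real j)\<bar> \<le> 5 * (freq j)^2" by (rule b(3))
  qed
qed

text \<open>From t/12 < (j+1)/2 and exp(1/2) at most 2, exp(T/12) is at most 2^(j+1), that is at
  most twice \<open>freq j\<close>. The theorem asks for one constant in both exponents, so the 1/12
  dictated by the inner one is used outside as well.\<close>

lemma double_exponential_decay:
  assumes "0 \<le> t" "T \<le> t"
  shows "\<bar>glue sol x y t\<bar> \<le> 10 * exp (freq 0) * exp (- (1/12) * exp ((1/12) * T))"
proof -
  define j where "j = nat \<lfloor>t / 6\<rfloor>"
  have j: "6 * real j \<le> t" "t < 6 * real j + 6"
    using glue_index_bounds[OF assms(1)] by (simp_all add: j_def)
  have "exp (1/2) \<le> (2::real)"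
    using exp_half_le2 by simp
  then have "exp (1/2) ^ Suc j \<le> (2::real) ^ Suc j" by (intro power_mono) auto
  moreover have "exp (1/12 * T) \<le> exp (real (Suc j) * (1/2))" using j assms by simp
  moreover have "exp (real (Suc j) * (1/2)) = exp (1/2 :: real) ^ Suc j" by (rule exp_of_nat_mult)
  ultimately have "exp (1/12 * T) \<le> 2 ^ Suc j" by linarith
  then have "1/12 * exp (1/12 * T) \<le> freq j" using freq_ge[of j] unfolding power_Suc by linarith
  then have "exp (freq 0 - freq j) \<le> exp (freq 0) * exp (- (1/12) * exp ((1/12) * T))"
    by (simp add: exp_add[symmetric])
  moreover have "\<bar>glue sol x y t\<bar> \<le> 10 * amp j"
    using sol_le[OF j(1)] by (simp add: glue_def j_def)
  ultimately show ?thesis using amp_le[of j] by linarith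
qed

section \<open>Periodicity and the shape of the solution on each interval\<close>

lemma periodic2_I:
  assumes "\<And>j x y t. F j (x + 2 * pi) y t = F j x y t" "\<And>j x y t. F j x (y + 2 * pi) t = F j x y t"
  shows "periodic2 (glue F)"
  using assms by (simp add: periodic2_def glue_def)

lemma periodic: "periodic2 (glue sol)" "periodic2 (glue (coeff i i'))"
proof -
  have 1: "cos (of_nat n * (z + 2 * pi)) = cos (of_nat n * z)" "sin (of_nat n * (z + 2 * pi)) = sin (of_nat n * z)"
    for n :: nat and z :: real
    unfolding distrib_left using cos.plus_of_nat[of "of_nat n * z" n] sin.plus_of_nat[of "of_nat n * z" n] by simp_all
  \<comment> \<open>Periodicity rests on the frequencies being integers, so they are displayed as
    images of natural numbers.\<close>
  have "px j = of_nat (pick j (2 ^ (j + n0)) (2 * 2 ^ (j + n0)))" "qy j = of_nat (pick j (2 * 2 ^ (j + n0)) (2 ^ (j + n0)))" for j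
    by (simp_all add: px_def qy_def pick_def freq_def)
  then have "cos (px j * (z + 2 * pi)) = cos (px j * z)" "sin (px j * (z + 2 * pi)) = sin (px j * z)"
    "cos (qy j * (z + 2 * pi)) = cos (qy j * z)" "sin (qy j * (z + 2 * pi)) = sin (qy j * z)" for j z
    by (simp_all only: 1)
  then show "periodic2 (glue sol)" "periodic2 (glue (coeff i i'))"
    by (auto intro!: periodic2_I simp: sol_def wave_def coeff_def coupling_def entry_def)
qed

definition ts :: "nat \<Rightarrow> real" where "ts n = 6 * (real n - 1)"

text \<open>The exponential converts the local-time amplitude to absolute time, as the theorem
  writes exp(-k t) with t counted from 0. The shift by 1 passes from n to \<open>j\<close>.\<close>

definition cs :: "nat \<Rightarrow> real" where "cs n = amp (n - 1) * exp (freq (n - 1) * (6 * real (n - 1)))"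

lemma filterlim_ts: "filterlim ts at_top sequentially"
proof -
  have "filterlim (\<lambda>n. - 1 + real n) at_top sequentially"
    by (rule filterlim_tendsto_add_at_top[OF tendsto_const filterlim_real_sequentially])
  then have "filterlim (\<lambda>n. 6 * (- 1 + real n)) at_top sequentially"
    by (rule filterlim_tendsto_pos_mult_at_top[OF tendsto_const, rotated]) simp
  then show ?thesis by (simp add: ts_def[abs_def])
qed

lemma interval_shape:
  assumes t: "6 * real j \<le> t" "t \<le> 6 * real (Suc j)"
  shows "glue sol x y t = scaled old0 j t * cos (freq j * pick j x y) + scaled new0 j t * cos (freq (Suc j) * pick j y x)"
proof -
  have "glue sol x y t = sol j x y t" using t by (intro glue_eq[OF compatible_sol]) auto
  then show ?thesis by (simp add: sol_def wave_def pick_def px_def qy_def freq_Suc)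
qed

text \<open>The profiles rest for a full unit of time at either end of an interval, so the required
  1/100 lies well inside.\<close>

lemma interval_start:
  assumes t: "6 * real j \<le> t" "t \<le> 6 * real j + 1/100"
  shows "glue sol x y t = cs (Suc j) * cos (freq j * pick j x y) * exp (- freq j * t)"
    "is_Id (\<lambda>i i'. glue (coeff i i')) x y t"
proof -
  have t': "t \<le> 6 * real j + 1" using t by simp
  have "glue sol x y t = sol j x y t" using t by (intro glue_eq[OF compatible_sol]) auto
  then show "glue sol x y t = cs (Suc j) * cos (freq j * pick j x y) * exp (- freq j * t)"
    by (simp add: sol_def wave_def pick_def px_def qy_def cs_def local_values[OF t'])
  have "glue (coeff i i') x y t = coeff i i' j x y t" for i i' using t by (intro glue_eq[OF compatible_coeff]) auto
  then show "is_Id (\<lambda>i i'. glue (coeff i i')) x y t"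
    using t' by (auto simp: is_Id_def coupling_identity less_2_cases_iff)
qed

lemma interval_end:
  assumes t: "6 * real (Suc j) - 1/100 \<le> t" "t \<le> 6 * real (Suc j)"
  shows "glue sol x y t = cs (Suc (Suc j)) * cos (freq (Suc j) * pick j y x) * exp (- freq (Suc j) * t)"
    "is_Id (\<lambda>i i'. glue (coeff i i')) x y t"
proof -
  have t': "6 * real j + 5 \<le> t" using t by simp
  have "glue sol x y t = sol j x y t" using t by (intro glue_eq[OF compatible_sol]) auto
  then show "glue sol x y t = cs (Suc (Suc j)) * cos (freq (Suc j) * pick j y x) * exp (- freq (Suc j) * t)"
    by (simp add: sol_def wave_def pick_def px_def qy_def cs_def local_values_late(1,2)[OF t'] freq_Suc del: amp.simps)
  have "glue (coeff i i') x y t = coeff i i' j x y t" for i i' using t by (intro glue_eq[OF compatible_coeff]) auto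
  then show "is_Id (\<lambda>i i'. glue (coeff i i')) x y t"
    using t' by (auto simp: is_Id_def coupling_identity less_2_cases_iff)
qed

end

theorem mainTheorem7:
  shows "\<exists>N::nat. \<forall>n0::nat. n0 \<ge> N \<longrightarrow>
   (\<exists>(A :: nat \<Rightarrow> nat \<Rightarrow> fn3) (u :: fn3) (c :: real) (C :: real) (ts :: nat \<Rightarrow> real) (cs :: nat \<Rightarrow> real).
      (\<forall>i<2. \<forall>j<2. periodic2 (A i j)) \<and> regclass 80 60 A \<and>
      periodic2 u \<and> unifC2 u \<and> (\<exists>x y t. t \<ge> 0 \<and> u x y t \<noteq> 0) \<and>
      solves_eq A u \<and>
      c > 0 \<and> C > 0 \<and>
      (\<exists>T0. \<forall>T\<ge>T0. \<forall>x y t. t \<ge> T \<longrightarrow> \<bar>u x y t\<bar> \<le> C * exp (- c * exp (c * T))) \<and>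
      ts 1 = 0 \<and> (\<forall>n\<ge>1. ts n \<ge> 0 \<and> ts n < ts (Suc n) \<and> ts (Suc n) - ts n > 3/100) \<and>
      filterlim ts at_top sequentially \<and>
      cs 1 = 1 \<and> (\<forall>n\<ge>1. cs n > 0) \<and>
      (\<forall>n\<ge>1. let k = (\<lambda>m::nat. (2::real) ^ (m + n0 - 1)) in
         (odd n \<longrightarrow>
           (\<exists>f g. unifC2_1 f \<and> unifC2_1 g \<and>
              (\<forall>x y t. ts n \<le> t \<and> t \<le> ts (Suc n) \<longrightarrow>
                 u x y t = f t * cos (k n * x) + g t * cos (k (Suc n) * y))) \<and>
           (\<forall>x y t. ts n \<le> t \<and> t \<le> ts n + 1/100 \<longrightarrow>
                 u x y t = cs n * cos (k n * x) * exp (- k n * t) \<and> is_Id A x y t) \<and>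
           (\<forall>x y t. ts (Suc n) - 1/100 \<le> t \<and> t \<le> ts (Suc n) \<longrightarrow>
                 u x y t = cs (Suc n) * cos (k (Suc n) * y) * exp (- k (Suc n) * t) \<and> is_Id A x y t)) \<and>
         (even n \<longrightarrow>
           (\<exists>f g. unifC2_1 f \<and> unifC2_1 g \<and>
              (\<forall>x y t. ts n \<le> t \<and> t \<le> ts (Suc n) \<longrightarrow>
                 u x y t = f t * cos (k n * y) + g t * cos (k (Suc n) * x))) \<and>
           (\<forall>x y t. ts n \<le> t \<and> t \<le> ts n + 1/100 \<longrightarrow>
                 u x y t = cs n * cos (k n * y) * exp (- k n * t) \<and> is_Id A x y t) \<and>
           (\<forall>x y t. ts (Suc n) - 1/100 \<le> t \<and> t \<le> ts (Suc n) \<longrightarrow>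
                 u x y t = cs (Suc n) * cos (k (Suc n) * x) * exp (- k (Suc n) * t) \<and> is_Id A x y t))))"
\<comment> \<open>The threshold is 10 because 2^10 = 1024 exceeds the 1000 demanded of every
  frequency.\<close>
proof (rule exI[of _ 10], rule allI, rule impI, goal_cases)
  case (1 n0)
  then interpret cascade n0 by unfold_locales
  \<comment> \<open>At the origin u equals \<open>cs 1\<close>, which is 1.\<close>
  have nonzero: "glue sol 0 0 0 \<noteq> 0"
    using interval_start(1)[of 0 0 0 0] by (simp add: cs_def pick_def)
  have decay: "\<exists>T0. \<forall>T\<ge>T0. \<forall>x y t. t \<ge> T \<longrightarrow>
      \<bar>glue sol x y t\<bar> \<le> 10 * exp (freq 0) * exp (- (1/12) * exp ((1/12) * T))"
    by (intro exI[of _ 0] allI impI double_exponential_decay) auto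
  have ts: "ts 1 = 0" "\<forall>n\<ge>1. ts n \<ge> 0 \<and> ts n < ts (Suc n) \<and> ts (Suc n) - ts n > 3/100"
    by (auto simp: ts_def)
  have cs: "cs 1 = 1" "\<forall>n\<ge>1. cs n > 0" using amp_pos by (auto simp: cs_def)
  have intervals: "let k = (\<lambda>m::nat. (2::real) ^ (m + n0 - 1)) in
         (odd n \<longrightarrow>
           (\<exists>f g. unifC2_1 f \<and> unifC2_1 g \<and>
              (\<forall>x y t. ts n \<le> t \<and> t \<le> ts (Suc n) \<longrightarrow>
                 glue sol x y t = f t * cos (k n * x) + g t * cos (k (Suc n) * y))) \<and>
           (\<forall>x y t. ts n \<le> t \<and> t \<le> ts n + 1/100 \<longrightarrow>
                 glue sol x y t = cs n * cos (k n * x) * exp (- k n * t) \<and> is_Id (\<lambda>i i'. glue (coeff i i')) x y t) \<and>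
           (\<forall>x y t. ts (Suc n) - 1/100 \<le> t \<and> t \<le> ts (Suc n) \<longrightarrow>
                 glue sol x y t = cs (Suc n) * cos (k (Suc n) * y) * exp (- k (Suc n) * t) \<and> is_Id (\<lambda>i i'. glue (coeff i i')) x y t)) \<and>
         (even n \<longrightarrow>
           (\<exists>f g. unifC2_1 f \<and> unifC2_1 g \<and>
              (\<forall>x y t. ts n \<le> t \<and> t \<le> ts (Suc n) \<longrightarrow>
                 glue sol x y t = f t * cos (k n * y) + g t * cos (k (Suc n) * x))) \<and>
           (\<forall>x y t. ts n \<le> t \<and> t \<le> ts n + 1/100 \<longrightarrow>
                 glue sol x y t = cs n * cos (k n * y) * exp (- k n * t) \<and> is_Id (\<lambda>i i'. glue (coeff i i')) x y t) \<and>
           (\<forall>x y t. ts (Suc n) - 1/100 \<le> t \<and> t \<le> ts (Suc n) \<longrightarrow>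
                 glue sol x y t = cs (Suc n) * cos (k (Suc n) * x) * exp (- k (Suc n) * t) \<and> is_Id (\<lambda>i i'. glue (coeff i i')) x y t))"
    if "1 \<le> n" for n
  proof -
    obtain j where n: "n = Suc j" using \<open>1 \<le> n\<close> by (cases n) auto
    have k: "2 ^ (n + n0 - 1) = freq j" "2 ^ (Suc n + n0 - 1) = freq (Suc j)" by (simp_all add: n freq_def)
    have t: "ts n = 6 * real j" "ts (Suc n) = 6 * real (Suc j)" by (simp_all add: ts_def n)
    note shape = interval_shape[of j] and start = interval_start[of j] and fin = interval_end[of j]
    show ?thesis
    \<comment> \<open>With n = \<open>Suc j\<close> the parities are opposite: odd n is the case of
      even \<open>j\<close>, where the old mode depends on x.\<close>
    proof (cases "even j")
      case True
      then have "odd n" by (simp add: n)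
      with True show ?thesis
        unfolding Let_def k t using shape start fin unifC2_1_scaled[of j]
        by (simp add: pick_def n) blast
    next
      case False
      then have "even n" by (simp add: n)
      with False show ?thesis
        unfolding Let_def k t using shape start fin unifC2_1_scaled[of j]
        by (simp add: pick_def n) blast
    qed
  qed
  have nontrivial: "\<exists>x y t. t \<ge> 0 \<and> glue sol x y t \<noteq> 0" using nonzero by force
  have periodic_A: "\<forall>i<2. \<forall>j<2. periodic2 (glue (coeff i j))" using periodic(2) by blast
  show ?case
    by (rule exI[of _ "\<lambda>i i'. glue (coeff i i')"], rule exI[of _ "glue sol"], rule exI[of _ "1/12"],
        rule exI[of _ "10 * exp (freq 0)"], rule exI[of _ ts], rule exI[of _ cs])
      (intro conjI periodic_A regular periodic(1) uniformly_C2 nontrivial solves decay ts filterlim_ts cs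
        allI impI intervals; simp)
qed

end
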